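(* Let $e\ge2$ and $\ell\ge2$ be integers, $\underline{s}=(s_0,\dots,s_{\ell-1})\in\mathbb{Z}^{\ell}$, $i\in\{1,\dots,\ell-1\}$, and let $\sigma_i(\underline{s})$ be obtained from $\underline{s}$ by exchanging $s_{i-1}$ and $s_i$. Let $\Sigma_{\underline{s},i}=\Gamma_{\underline{s},\sigma_i(\underline{s})}$ be the crystal isomorphism from $B_e^{\underline{s}}(\Lambda_{\underline{\mathfrak{s}}}^{+})$ to $B_e^{\sigma_i(\underline{s})}(\Lambda_{\underline{\mathfrak{s}}}^{+})$. Let $\underline{\lambda}=(\lambda^{(0)},\dots,\lambda^{(\ell-1)})\in B_e^{\underline{s}}(\Lambda_{\underline{\mathfrak{s}}}^{+})$ and define partitions $\widetilde{\lambda}^{(i-1)},\widetilde{\lambda}^{(i)}$ by $$\psi_{s_i,s_{i-1}}(\lambda^{(i)}\otimes\lambda^{(i-1)})=\widetilde{\lambda}^{(i-1)}\otimes\widetilde{\lambda}^{(i)},$$ where $\psi_{s_i,s_{i-1}}:B_\infty(\omega_{s_i})\otimes B_\infty(\omega_{s_{i-1}})\to B_\infty(\omega_{s_{i-1}})\otimes B_\infty(\omega_{s_i})$ is the isomorphism of $\mathcal{U}_v(\mathfrak{sl}_\infty)$-crystals. Then $\Sigma_{\underline{s},i}(\underline{\lambda})$ is obtained from $\underline{\lambda}$ by replacing $\lambda^{(i-1)}$ by $\widetilde{\lambda}^{(i)}$ and $\lambda^{(i)}$ by $\widetilde{\lambda}^{(i-1)}$: $$\Sigma_{\underline{s},i}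(\underline{\lambda})=(\lambda^{(0)},\dots,\lambda^{(i-2)},\widetilde{\lambda}^{(i)},\widetilde{\lambda}^{(i-1)},\lambda^{(i+1)},\dots,\lambda^{(\ell-1)}).$$
   Context: A multipartition of length $\ell$ is an $\ell$-tuple of partitions; $\underline{\emptyset}$ is the empty one. A node is a triple $\gamma=(a,b,c)$: the box in row $a\ge1$ and column $b\ge1$ of component $c\in\{0,\dots,\ell-1\}$. It is removable if it belongs to $\underline{\lambda}$ and deleting it leaves a multipartition; addable if it is not in $\underline{\lambda}$ and adding it gives a multipartition. For a multicharge $\underline{s}\in\mathbb{Z}^\ell$ the content is $c(\gamma)=b-a+s_c$, and $\gamma$ is an $i$-node if $c(\gamma)\equiv i\pmod e$. Crystal $B_e^{\underline{s}}(\Lambda_{\underline{\mathfrak{s}}}^{+})$: order $i$-nodes by $\gamma_1\prec_{\underline{s}}^{+}\gamma_2$ iff $c(\gamma_1)<c(\gamma_2)$, or $c(\gamma_1)=c(\gamma_2)$ and $c_1<c_2$ (component indices). For $i\in\{0,\dots,e-1\}$ write the addable and removable $i$-nodes of $\underline{\lambda}$ in decreasing order for $\prec_{\underline{s}}^{+}$, encode addable nodes by $A$ and removable ones by $R$, and delete factors $RA$ repeatedly until a word $A^pR^q$ remains. If $p>0$, the node of the rightmost remaining $A$ is the good $i$-node, and there is an arrow $\underline{\lambda}\xrightarrow{i}\underline{\mu}$ iff $\underline{\mu}$ is $\underline{\lambda}$ with its good $i$-node added. $B_e^{\underline{s}}(\Lambda_{\underline{\mathfrak{s}}}^{+})$ is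 the connected component of $\underline{\emptyset}$ in the resulting graph on all multipartitions of length $\ell$. It realizes the crystal of the irreducible $\mathcal{U}_v(\widehat{\mathfrak{sl}}_e)$-module of highest weight $\sum_k\Lambda_{s_k\bmod e}$. If $\underline{s}$ and $\underline{s}'$ have the same multiset of residues modulo $e$, these highest weights coincide and $\Gamma_{\underline{s},\underline{s}'}$ denotes the unique isomorphism of $\{0,\dots,e-1\}$-arrow-labelled graphs $B_e^{\underline{s}}(\Lambda_{\underline{\mathfrak{s}}}^{+})\to B_e^{\underline{s}'}(\Lambda_{\underline{\mathfrak{s}}}^{+})$; it sends $\underline{\emptyset}$ to $\underline{\emptyset}$. Type $A_\infty$: for $k,l\in\mathbb{Z}$, the vertices of $B_\infty(\omega_k)\otimes B_\infty(\omega_l)$ are pairs of partitions $\mu\otimes\nu$, the node in row $a$, column $b$ having content $b-a+k$ in $\mu$ and $b-a+l$ in $\nu$. For $j\in\mathbb{Z}$, read the addable ($A$) and removable ($R$) nodes of content exactly $j$ first in $\mu$ and then in $\nu$ (at most one in each), and delete the factor $RA$ if it occurs, leaving $A^pR^q$; $\widetilde{f}_j$ adds the node of the rightmost remaining $A$ ($0$ if $p=0$) and $\widetilde{e}_j$ removes the node of the leftmost remaining $R$ ($0$ if $q=0$). The crystals $B_\infty(\omega_k)\otimes B_\infty(\omega_l)$ and $B_\infty(\omega_l)\otimes B_\infty(\omega_k)$ are isomorphic and $\psi_{k,l}$ denotes the crystal isomorphism between them (the bijection commuting with all $\widetilde{e}_j,\widetilde{f}_j$). *)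

theory Defs
  imports Main "HOL-Number_Theory.Cong"
begin

section \<open>Partitions, multipartitions and nodes\<close>

definition partitions :: "nat list set" where
  "partitions = {p. sorted_wrt (\<ge>) p \<and> 0 \<notin> set p}"

definition multipartitions :: "nat \<Rightarrow> nat list list set" where
  "multipartitions l = {L. length L = l \<and> set L \<subseteq> partitions}"

definition empty_multipartition :: "nat \<Rightarrow> nat list list" where
  "empty_multipartition l = replicate l []"

text \<open>Rows and columns of a node \<open>(a, b, c)\<close> are numbered from 1, components \<open>c\<close> from 0.\<close>

type_synonym node = "nat \<times> nat \<times> nat"

definition nodes :: "nat list list \<Rightarrow> node set" where
  "nodes L = {(a, b, c). c < length L \<and> 1 \<le> a \<and> a \<le> length (L ! c) \<and> 1 \<le> b \<and> b \<le> L ! c ! (a - 1)}"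

definition addable :: "nat list list \<Rightarrow> node \<Rightarrow> bool" where
  "addable L \<gamma> \<longleftrightarrow> \<gamma> \<notin> nodes L \<and> (\<exists>M \<in> multipartitions (length L). nodes M = insert \<gamma> (nodes L))"

definition removable :: "nat list list \<Rightarrow> node \<Rightarrow> bool" where
  "removable L \<gamma> \<longleftrightarrow> \<gamma> \<in> nodes L \<and> (\<exists>M \<in> multipartitions (length L). nodes M = nodes L - {\<gamma>})"

definition add_node :: "nat list list \<Rightarrow> node \<Rightarrow> nat list list" where
  "add_node L \<gamma> = (THE M. M \<in> multipartitions (length L) \<and> nodes M = insert \<gamma> (nodes L))"

definition remove_node :: "nat list list \<Rightarrow> node \<Rightarrow> nat list list" where
  "remove_node L \<gamma> = (THE M. M \<in> multipartitions (length L) \<and> nodes M = nodes L - {\<gamma>})"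

definition component :: "node \<Rightarrow> nat" where
  "component = (\<lambda>(a, b, c). c)"

definition content :: "int list \<Rightarrow> node \<Rightarrow> int" where
  "content s = (\<lambda>(a, b, c). int b - int a + s ! c)"

section \<open>Signature words\<close>

datatype letter = Addable | Removable

inductive delete_RA :: "(letter \<times> node) list \<Rightarrow> (letter \<times> node) list \<Rightarrow> bool" where
  "delete_RA (u @ [(Removable, \<gamma>), (Addable, \<delta>)] @ v) (u @ v)"

definition reduced_word :: "(letter \<times> node) list \<Rightarrow> (letter \<times> node) list" where
  "reduced_word w = (THE w'. delete_RA\<^sup>*\<^sup>* w w' \<and>
     (\<exists>p q. map fst w' = replicate p Addable @ replicate q Removable))"

text \<open>The addable and removable nodes satisfying \<open>P\<close>, tagged and listed in the order of the strict
  relation \<open>before\<close>, which has to be total on them.\<close>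

definition signature_word ::
    "(node \<Rightarrow> node \<Rightarrow> bool) \<Rightarrow> (node \<Rightarrow> bool) \<Rightarrow> nat list list \<Rightarrow> (letter \<times> node) list" where
  "signature_word before P L = (THE w. sorted_wrt (\<lambda>x y. before (snd x) (snd y)) w \<and>
     set w = {(Addable, \<gamma>) |\<gamma>. addable L \<gamma> \<and> P \<gamma>} \<union> {(Removable, \<gamma>) |\<gamma>. removable L \<gamma> \<and> P \<gamma>})"

definition remaining ::
    "letter \<Rightarrow> (node \<Rightarrow> node \<Rightarrow> bool) \<Rightarrow> (node \<Rightarrow> bool) \<Rightarrow> nat list list \<Rightarrow> node list" where
  "remaining x before P L =
     map snd (filter (\<lambda>y. fst y = x) (reduced_word (signature_word before P L)))"

text \<open>The value \<open>0\<close> of a crystal operator is rendered as \<open>None\<close>.\<close>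

definition f_op ::
    "(node \<Rightarrow> node \<Rightarrow> bool) \<Rightarrow> (node \<Rightarrow> bool) \<Rightarrow> nat list list \<Rightarrow> nat list list option" where
  "f_op before P L = (let \<gamma>s = remaining Addable before P L
     in if \<gamma>s = [] then None else Some (add_node L (last \<gamma>s)))"

definition e_op ::
    "(node \<Rightarrow> node \<Rightarrow> bool) \<Rightarrow> (node \<Rightarrow> bool) \<Rightarrow> nat list list \<Rightarrow> nat list list option" where
  "e_op before P L = (let \<gamma>s = remaining Removable before P L
     in if \<gamma>s = [] then None else Some (remove_node L (hd \<gamma>s)))"

section \<open>The affine crystals\<close>

definition node_less :: "int list \<Rightarrow> node \<Rightarrow> node \<Rightarrow> bool" where
  "node_less s \<gamma> \<delta> \<longleftrightarrow> content s \<gamma> < content s \<delta> \<or>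
     (content s \<gamma> = content s \<delta> \<and> component \<gamma> < component \<delta>)"

definition arrow :: "nat \<Rightarrow> int list \<Rightarrow> nat \<Rightarrow> nat list list \<Rightarrow> nat list list \<Rightarrow> bool" where
  "arrow e s i L M \<longleftrightarrow> i < e \<and> L \<in> multipartitions (length s) \<and>
     f_op (\<lambda>\<gamma> \<delta>. node_less s \<delta> \<gamma>) (\<lambda>\<gamma>. [content s \<gamma> = int i] (mod int e)) L = Some M"

definition affine_crystal :: "nat \<Rightarrow> int list \<Rightarrow> nat list list set" where
  "affine_crystal e s =
     {L. equivclp (\<lambda>M N. \<exists>i. arrow e s i M N) (empty_multipartition (length s)) L}"

definition affine_crystal_iso ::
    "nat \<Rightarrow> int list \<Rightarrow> int list \<Rightarrow> (nat list list \<Rightarrow> nat list list) \<Rightarrow> bool" where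
  "affine_crystal_iso e s s' \<Gamma> \<longleftrightarrow>
     bij_betw \<Gamma> (affine_crystal e s) (affine_crystal e s') \<and>
     (\<forall>L \<in> affine_crystal e s. \<forall>M \<in> affine_crystal e s. \<forall>i < e.
        arrow e s i L M \<longleftrightarrow> arrow e s' i (\<Gamma> L) (\<Gamma> M))"

section \<open>Tensor products of two fundamental crystals of type $A_\infty$\<close>

text \<open>The vertex \<open>\<mu> \<otimes> \<nu>\<close> of \<open>B(\<omega>\<^sub>k) \<otimes> B(\<omega>\<^sub>l)\<close> is the pair \<open>(\<mu>, \<nu>)\<close>, and its nodes are those of the
  multipartition \<open>[\<mu>, \<nu>]\<close> for the multicharge \<open>[k, l]\<close>.\<close>

definition tensor_f :: "int \<Rightarrow> int \<Rightarrow> int \<Rightarrow> nat list \<times> nat list \<Rightarrow> (nat list \<times> nat list) option" where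
  "tensor_f k l j = (\<lambda>(\<mu>, \<nu>). map_option (\<lambda>M. (M ! 0, M ! 1))
     (f_op (\<lambda>\<gamma> \<delta>. component \<gamma> < component \<delta>) (\<lambda>\<gamma>. content [k, l] \<gamma> = j) [\<mu>, \<nu>]))"

definition tensor_e :: "int \<Rightarrow> int \<Rightarrow> int \<Rightarrow> nat list \<times> nat list \<Rightarrow> (nat list \<times> nat list) option" where
  "tensor_e k l j = (\<lambda>(\<mu>, \<nu>). map_option (\<lambda>M. (M ! 0, M ! 1))
     (e_op (\<lambda>\<gamma> \<delta>. component \<gamma> < component \<delta>) (\<lambda>\<gamma>. content [k, l] \<gamma> = j) [\<mu>, \<nu>]))"

definition tensor_crystal_iso ::
    "int \<Rightarrow> int \<Rightarrow> (nat list \<times> nat list \<Rightarrow> nat list \<times> nat list) \<Rightarrow> bool" where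
  "tensor_crystal_iso k l \<psi> \<longleftrightarrow>
     bij_betw \<psi> (partitions \<times> partitions) (partitions \<times> partitions) \<and>
     (\<forall>x \<in> partitions \<times> partitions. \<forall>j.
        tensor_f l k j (\<psi> x) = map_option \<psi> (tensor_f k l j x) \<and>
        tensor_e l k j (\<psi> x) = map_option \<psi> (tensor_e k l j x))"

section \<open>The definite descriptions above are well defined\<close>

subsection \<open>Reduced words\<close>

fun cancel :: "(letter \<times> node) list \<Rightarrow> (letter \<times> node) list" where
  "cancel [] = []"
| "cancel (x # w) = (case cancel w of
     [] \<Rightarrow> [x]
   | y # w' \<Rightarrow> if fst x = Removable \<and> fst y = Addable then w' else x # y # w')"

lemma cancel_normal: "\<exists>p q. map fst (cancel w) = replicate p Addable @ replicate q Removable"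
proof (induction w)
  case Nil
  show ?case by (intro exI[of _ 0]) simp
next
  case (Cons x w)
  then obtain p q where pq: "map fst (cancel w) = replicate p Addable @ replicate q Removable"
    by blast
  show ?case
  proof (cases "fst x")
    case Addable
    then have "map fst (cancel (x # w)) = replicate (Suc p) Addable @ replicate q Removable"
      using pq by (cases "cancel w") auto
    then show ?thesis by blast
  next
    case Removable
    show ?thesis
    proof (cases p)
      case 0
      then have "map fst (cancel (x # w)) = replicate 0 Addable @ replicate (Suc q) Removable"
        using pq Removable by (cases "cancel w"; cases q) auto
      then show ?thesis by blast
    next
      case (Suc p')
      then have "map fst (cancel (x # w)) = replicate p' Addable @ replicate q Removable"
        using pq Removable by (cases "cancel w") auto
      then show ?thesis by blast
    qed
  qed
qed

lemma delete_RA_Cons: "delete_RA w w' \<Longrightarrow> delete_RA (x # w) (x # w')"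
proof (induction rule: delete_RA.induct)
  case (1 u \<gamma> \<delta> v)
  show ?case using delete_RA.intros[of "x # u" \<gamma> \<delta> v] by simp
qed

lemma delete_RA_star_Cons: "delete_RA\<^sup>*\<^sup>* w w' \<Longrightarrow> delete_RA\<^sup>*\<^sup>* (x # w) (x # w')"
  by (induction rule: rtranclp_induct) (auto dest: delete_RA_Cons intro: rtranclp.rtrancl_into_rtrancl)

lemma delete_RA_star_cancel: "delete_RA\<^sup>*\<^sup>* w (cancel w)"
proof (induction w)
  case (Cons x w)
  have 1: "delete_RA\<^sup>*\<^sup>* (x # w) (x # cancel w)"
    using Cons by (rule delete_RA_star_Cons)
  have "delete_RA\<^sup>*\<^sup>* (x # cancel w) (cancel (x # w))"
  proof (cases "cancel w")
    case (Cons y w')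
    have "delete_RA (x # y # w') w'" if "fst x = Removable" "fst y = Addable"
      using that delete_RA.intros[of "[]" "snd x" "snd y" w'] by (cases x; cases y) simp
    then show ?thesis using Cons by auto
  qed simp
  with 1 show ?case by (rule rtranclp_trans)
qed simp

lemma cancel_cong: "cancel v = cancel v' \<Longrightarrow> cancel (u @ v) = cancel (u @ v')"
  by (induction u) auto

lemma cancel_delete_RA: "delete_RA w w' \<Longrightarrow> cancel w = cancel w'"
proof (induction rule: delete_RA.induct)
  case (1 u \<gamma> \<delta> v)
  obtain p q where "map fst (cancel v) = replicate p Addable @ replicate q Removable"
    using cancel_normal by blast
  then have "cancel ([(Removable, \<gamma>), (Addable, \<delta>)] @ v) = cancel v"
    by (auto split: list.splits)
  then show ?case by (rule cancel_cong)
qed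

lemma cancel_id:
  "map fst w = replicate p Addable @ replicate q Removable \<Longrightarrow> cancel w = w"
proof (induction w arbitrary: p q)
  case (Cons x w)
  show ?case
  proof (cases p)
    case 0
    then obtain q' where "q = Suc q'" using Cons.prems by (cases q) auto
    then have *: "map fst w = replicate 0 Addable @ replicate q' Removable"
      using Cons.prems 0 by simp
    then have "cancel w = w" by (rule Cons.IH)
    moreover have "fst (hd w) \<noteq> Addable" if "w \<noteq> []"
      using * that by (cases w; cases q') auto
    ultimately show ?thesis by (cases w) auto
  next
    case (Suc p')
    then have "map fst w = replicate p' Addable @ replicate q Removable" "fst x = Addable"
      using Cons.prems by auto
    then show ?thesis using Cons.IH by (cases w) auto
  qed
qed simp

lemma reduced_word_eq_cancel: "reduced_word w = cancel w"
  unfolding reduced_word_def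
proof (rule the_equality)
  fix w'
  assume *: "delete_RA\<^sup>*\<^sup>* w w' \<and> (\<exists>p q. map fst w' = replicate p Addable @ replicate q Removable)"
  then have "delete_RA\<^sup>*\<^sup>* w w'" by blast
  then have "cancel w = cancel w'"
    by (induction rule: rtranclp_induct) (auto dest: cancel_delete_RA)
  then show "w' = cancel w" using * cancel_id by metis
qed (use cancel_normal delete_RA_star_cancel in blast)

subsection \<open>Adding and removing nodes\<close>

lemma inj_on_nodes: "inj_on nodes (multipartitions l)"
proof (rule inj_onI)
  fix L M assume L: "L \<in> multipartitions l" and M: "M \<in> multipartitions l" and eq: "nodes L = nodes M"
  have len: "length L = l" "length M = l" using L M by (auto simp: multipartitions_def)
  have pos: "0 < N ! c ! a" if "N \<in> multipartitions l" "c < l" "a < length (N ! c)" for N c a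
    using that by (metis (mono_tags, lifting) gr0I mem_Collect_eq multipartitions_def nth_mem
        partitions_def subsetD)
  have mem: "(Suc a, b, c) \<in> nodes N \<longleftrightarrow> a < length (N ! c) \<and> 1 \<le> b \<and> b \<le> N ! c ! a"
    if "N \<in> multipartitions l" "c < l" for N a b c
    using that by (auto simp: nodes_def multipartitions_def)
  show "L = M"
  proof (rule nth_equalityI)
    fix c assume "c < length L"
    then have c: "c < l" using len by simp
    have iff: "a < length (L ! c) \<and> 1 \<le> b \<and> b \<le> L ! c ! a \<longleftrightarrow>
        a < length (M ! c) \<and> 1 \<le> b \<and> b \<le> M ! c ! a" for a b
      using mem[OF L c] mem[OF M c] eq by simp
    have rows: "a < length (L ! c) \<longleftrightarrow> a < length (M ! c)" for a
      using iff[of a 1] pos[OF L c, of a] pos[OF M c, of a] by auto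
    then have "length (L ! c) = length (M ! c)" by (metis linorder_neqE_nat less_irrefl)
    moreover have "L ! c ! a = M ! c ! a" if "a < length (L ! c)" for a
      using iff[of a "L ! c ! a"] iff[of a "M ! c ! a"] that rows[of a] pos[OF L c, of a] pos[OF M c, of a]
      by auto
    ultimately show "L ! c = M ! c" by (rule nth_equalityI)
  qed (use len in simp)
qed

lemma add_node:
  assumes "addable L \<gamma>"
  shows "add_node L \<gamma> \<in> multipartitions (length L)" "nodes (add_node L \<gamma>) = insert \<gamma> (nodes L)"
proof -
  have "\<exists>!M. M \<in> multipartitions (length L) \<and> nodes M = insert \<gamma> (nodes L)"
    using assms inj_onD[OF inj_on_nodes] unfolding addable_def by metis
  from theI'[OF this]
  show "add_node L \<gamma> \<in> multipartitions (length L)" "nodes (add_node L \<gamma>) = insert \<gamma> (nodes L)"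
    by (simp_all add: add_node_def)
qed

lemma remove_node:
  assumes "removable L \<gamma>"
  shows "remove_node L \<gamma> \<in> multipartitions (length L)" "nodes (remove_node L \<gamma>) = nodes L - {\<gamma>}"
proof -
  have "\<exists>!M. M \<in> multipartitions (length L) \<and> nodes M = nodes L - {\<gamma>}"
    using assms inj_onD[OF inj_on_nodes] unfolding removable_def by metis
  from theI'[OF this]
  show "remove_node L \<gamma> \<in> multipartitions (length L)" "nodes (remove_node L \<gamma>) = nodes L - {\<gamma>}"
    by (simp_all add: remove_node_def)
qed

subsection \<open>Listing the addable and removable nodes\<close>

lemma ex1_sorted_wrt:
  assumes "finite S" "transp_on S R" "irreflp_on S R" "totalp_on S R"
  shows "\<exists>!w. sorted_wrt R w \<and> set w = S"
  using assms
proof (induction "card S" arbitrary: S)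
  case 0
  then show ?case by (intro ex1I[of _ "[]"]) auto
next
  case (Suc n)
  have asym: "asymp_on S R"
  proof (rule asymp_onI)
    fix x y assume xy: "x \<in> S" "y \<in> S" "R x y"
    show "\<not> R y x"
      using transp_onD[OF Suc.prems(2) xy(1,2,1) xy(3)] irreflp_onD[OF Suc.prems(3) xy(1)] by blast
  qed
  have "S \<noteq> {}" using Suc.hyps(2) by auto
  then obtain m where m_min: "m \<in> S" "\<forall>x\<in>S. x \<noteq> m \<longrightarrow> \<not> R x m"
    using Finite_Set.bex_min_element[OF Suc.prems(1) asym Suc.prems(2)] by blast
  have m: "m \<in> S" "\<And>x. x \<in> S \<Longrightarrow> x \<noteq> m \<Longrightarrow> R m x"
    using m_min totalp_onD[OF Suc.prems(4)] by blast+
  have IH: "\<exists>!w. sorted_wrt R w \<and> set w = S - {m}"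
  proof (rule Suc.hyps(1))
    show "n = card (S - {m})" using Suc.hyps(2) Suc.prems(1) m(1) by simp
    show "finite (S - {m})" using Suc.prems(1) by simp
    show "transp_on (S - {m}) R" using Suc.prems(2) Diff_subset by (rule transp_on_subset)
    show "irreflp_on (S - {m}) R" using Suc.prems(3) Diff_subset by (rule irreflp_on_subset)
    show "totalp_on (S - {m}) R" using Suc.prems(4) Diff_subset by (rule totalp_on_subset)
  qed
  then obtain w where w: "sorted_wrt R w" "set w = S - {m}" by blast
  show ?case
  proof (rule ex1I[of _ "m # w"])
    show "sorted_wrt R (m # w) \<and> set (m # w) = S" using w m by auto
  next
    fix v assume v: "sorted_wrt R v \<and> set v = S"
    then obtain x v' where v': "v = x # v'" using m(1) by (cases v) auto
    have x: "x \<in> S" "\<And>y. y \<in> set v' \<Longrightarrow> R x y" "set v' \<subseteq> S" using v v' by auto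
    have "x = m"
    proof (rule ccontr)
      assume "x \<noteq> m"
      then have "m \<in> set v'" using v v' m(1) by auto
      then show False using x(2) m(2)[OF x(1) \<open>x \<noteq> m\<close>] asymp_onD[OF asym m(1) x(1)] by blast
    qed
    moreover have "m \<notin> set v'"
      using x(2) \<open>x = m\<close> irreflp_onD[OF Suc.prems(3) m(1)] by blast
    ultimately have "sorted_wrt R v' \<and> set v' = S - {m}" using v v' by auto
    then show "v = m # w" using IH w \<open>x = m\<close> v' by blast
  qed
qed

lemma nodes_downward:
  assumes "L \<in> multipartitions l" "(a, b, c) \<in> nodes L" "1 \<le> a'" "a' \<le> a" "1 \<le> b'" "b' \<le> b"
  shows "(a', b', c) \<in> nodes L"
proof -
  have c: "c < length L" and a: "a \<le> length (L ! c)" and b: "b \<le> L ! c ! (a - 1)"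
    using assms(2) by (auto simp: nodes_def)
  have "sorted_wrt (\<ge>) (L ! c)"
    using assms(1) c by (auto simp: multipartitions_def partitions_def dest: nth_mem)
  moreover have "a' - 1 < a - 1" if "a' \<noteq> a" using that assms(3,4) by simp
  ultimately have "L ! c ! (a - 1) \<le> L ! c ! (a' - 1)"
    using a assms(3,4) by (cases "a' = a") (auto simp: sorted_wrt_iff_nth_less)
  then show ?thesis using assms c a b by (auto simp: nodes_def)
qed

lemma nodes_pos: "(a, b, c) \<in> nodes L \<Longrightarrow> 1 \<le> a \<and> 1 \<le> b \<and> c < length L"
  by (auto simp: nodes_def)

lemma addable_downward:
  assumes "addable L (a, b, c)" "1 \<le> a'" "a' \<le> a" "1 \<le> b'" "b' \<le> b" "(a', b') \<noteq> (a, b)"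
  shows "(a', b', c) \<in> nodes L"
proof -
  obtain M where M: "M \<in> multipartitions (length L)" "nodes M = insert (a, b, c) (nodes L)"
    using assms(1) by (auto simp: addable_def)
  have "(a', b', c) \<in> nodes M"
    by (rule nodes_downward[of M _ a b]) (use M assms in auto)
  then show ?thesis using M assms(6) by auto
qed

lemma addable_pos: "addable L (a, b, c) \<Longrightarrow> 1 \<le> a \<and> 1 \<le> b \<and> c < length L"
proof -
  assume "addable L (a, b, c)"
  then obtain M where M: "M \<in> multipartitions (length L)" "nodes M = insert (a, b, c) (nodes L)"
    by (auto simp: addable_def)
  then show ?thesis using nodes_pos[of a b c M] by (auto simp: multipartitions_def)
qed

lemma removable_maximal:
  assumes "removable L (a, b, c)" "a \<le> a'" "b \<le> b'" "(a', b', c) \<in> nodes L"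
  shows "(a', b') = (a, b)"
proof (rule ccontr)
  assume ne: "(a', b') \<noteq> (a, b)"
  obtain M where M: "M \<in> multipartitions (length L)" "nodes M = nodes L - {(a, b, c)}"
      and abc: "(a, b, c) \<in> nodes L"
    using assms(1) by (auto simp: removable_def)
  have "(a, b, c) \<in> nodes M"
    by (rule nodes_downward[of M _ a' b']) (use M assms ne nodes_pos[OF abc] in auto)
  then show False using M by auto
qed

lemma finite_nodes: "finite (nodes L)"
proof (rule finite_subset)
  show "nodes L \<subseteq> (\<Union>c<length L. \<Union>a<length (L ! c). {Suc a} \<times> {..L ! c ! a} \<times> {c})"
  proof
    fix \<gamma> assume \<gamma>: "\<gamma> \<in> nodes L"
    obtain a b c where abc: "\<gamma> = (a, b, c)" by (cases \<gamma>)
    then have "c < length L" "a - 1 < length (L ! c)" "b \<le> L ! c ! (a - 1)" "a = Suc (a - 1)"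
      using \<gamma> by (auto simp: nodes_def)
    then show "\<gamma> \<in> (\<Union>c<length L. \<Union>a<length (L ! c). {Suc a} \<times> {..L ! c ! a} \<times> {c})"
      unfolding abc by blast
  qed
qed auto

lemma finite_addable: "finite {\<gamma>. addable L \<gamma>}"
proof (rule finite_subset)
  show "{\<gamma>. addable L \<gamma>} \<subseteq> (\<lambda>(a, b, c). (Suc a, b, c)) ` nodes L \<union>
      (\<lambda>(a, b, c). (a, Suc b, c)) ` nodes L \<union> {1} \<times> {1} \<times> {..<length L}"
  proof
    fix \<gamma> assume \<gamma>: "\<gamma> \<in> {\<gamma>. addable L \<gamma>}"
    obtain a b c where abc: "\<gamma> = (a, b, c)" by (cases \<gamma>)
    then have add: "addable L (a, b, c)" using \<gamma> by simp
    note pos = addable_pos[OF add]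
    consider "a = 1" "b = 1" | "a > 1" | "b > 1" using pos by linarith
    then show "\<gamma> \<in> (\<lambda>(a, b, c). (Suc a, b, c)) ` nodes L \<union>
      (\<lambda>(a, b, c). (a, Suc b, c)) ` nodes L \<union> {1} \<times> {1} \<times> {..<length L}"
    proof cases
      case 1
      then show ?thesis using abc pos by simp
    next
      case 2
      then have "(a - 1, b, c) \<in> nodes L" using pos by (intro addable_downward[OF add]) auto
      from imageI[OF this, of "\<lambda>(a, b, c). (Suc a, b, c)"] show ?thesis using abc 2 by simp
    next
      case 3
      then have "(a, b - 1, c) \<in> nodes L" using pos by (intro addable_downward[OF add]) auto
      from imageI[OF this, of "\<lambda>(a, b, c). (a, Suc b, c)"] show ?thesis using abc 3 by simp
    qed
  qed
qed (simp add: finite_nodes)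

lemma same_diagonal:
  assumes "content s (a, b, c) = content s (a', b', c)" "a \<le> a'"
  obtains d where "a' = a + d" "b' = b + d"
proof -
  have "b' = b + (a' - a)" using assms by (simp add: content_def)
  then show thesis using that[of "a' - a"] assms(2) by simp
qed

text \<open>A component has at most one addable or removable node of a given content.\<close>

lemma tagged_node_unique:
  assumes L: "L \<in> multipartitions l"
    and x: "x = Addable \<and> addable L \<gamma> \<or> x = Removable \<and> removable L \<gamma>"
    and y: "y = Addable \<and> addable L \<delta> \<or> y = Removable \<and> removable L \<delta>"
    and eq: "content s \<gamma> = content s \<delta>" "component \<gamma> = component \<delta>"
  shows "x = y \<and> \<gamma> = \<delta>"
proof -
  have *: "x = y \<and> a = a' \<and> b = b'"
    if x: "x = Addable \<and> addable L (a, b, c) \<or> x = Removable \<and> removable L (a, b, c)"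
      and y: "y = Addable \<and> addable L (a', b', c) \<or> y = Removable \<and> removable L (a', b', c)"
      and cont: "content s (a, b, c) = content s (a', b', c)" and le: "a \<le> a'"
    for x y a b c a' b'
  proof -
    obtain d where d: "a' = a + d" "b' = b + d" using same_diagonal[OF cont le] .
    have pos: "1 \<le> a" "1 \<le> b"
      using x addable_pos nodes_pos by (auto simp: removable_def)
    have not_add: "\<not> addable L (a, b, c)" if "(a', b', c) \<in> nodes L"
      using nodes_downward[OF L that, of a b] pos d by (auto simp: addable_def)
    from x y show ?thesis
    proof (elim disjE conjE)
      assume "x = Addable" "addable L (a, b, c)" "y = Addable" "addable L (a', b', c)"
      then show ?thesis using addable_downward[of L a' b' c a b] pos d
        by (cases "d = 0") (auto simp: addable_def)
    next
      assume "addable L (a, b, c)" "removable L (a', b', c)"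
      then show ?thesis using not_add by (auto simp: removable_def)
    next
      assume rem: "removable L (a, b, c)" and add: "addable L (a', b', c)"
      have "d \<noteq> 0" using rem add d by (auto simp: addable_def removable_def)
      then have "(a + 1, b, c) \<in> nodes L" using pos d by (intro addable_downward[OF add]) auto
      then show ?thesis using removable_maximal[OF rem, of "a + 1" b] by simp
    next
      assume "x = Removable" "removable L (a, b, c)" "y = Removable" "removable L (a', b', c)"
      then show ?thesis using removable_maximal[of L a b c a' b'] d
        by (auto simp: removable_def)
    qed
  qed
  obtain a b c where \<gamma>: "\<gamma> = (a, b, c)" by (cases \<gamma>)
  obtain a' b' where \<delta>: "\<delta> = (a', b', c)" using eq(2) \<gamma> by (cases \<delta>) (auto simp: component_def)
  show ?thesis
  proof (cases "a \<le> a'")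
    case True
    then show ?thesis using *[of x a b c y a' b'] x y eq(1) \<gamma> \<delta> by simp
  next
    case False
    then show ?thesis using *[of y a' b' c x a b] x y eq(1) \<gamma> \<delta> by simp
  qed
qed

lemma signature_word:
  assumes L: "L \<in> multipartitions l" and "transp before" "irreflp before"
    and total: "\<And>\<gamma> \<delta>. P \<gamma> \<Longrightarrow> P \<delta> \<Longrightarrow> (content s \<gamma>, component \<gamma>) \<noteq> (content s \<delta>, component \<delta>) \<Longrightarrow>
      before \<gamma> \<delta> \<or> before \<delta> \<gamma>"
  shows "sorted_wrt (\<lambda>x y. before (snd x) (snd y)) (signature_word before P L)"
    and "set (signature_word before P L) =
      {(Addable, \<gamma>) |\<gamma>. addable L \<gamma> \<and> P \<gamma>} \<union> {(Removable, \<gamma>) |\<gamma>. removable L \<gamma> \<and> P \<gamma>}"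
proof -
  let ?S = "{(Addable, \<gamma>) |\<gamma>. addable L \<gamma> \<and> P \<gamma>} \<union> {(Removable, \<gamma>) |\<gamma>. removable L \<gamma> \<and> P \<gamma>}"
  let ?R = "\<lambda>x y. before (snd x) (snd y)"
  have "?S \<subseteq> Pair Addable ` {\<gamma>. addable L \<gamma>} \<union> Pair Removable ` nodes L"
    by (auto simp: removable_def)
  then have "finite ?S" by (rule finite_subset) (simp add: finite_addable finite_nodes)
  moreover have "transp_on ?S ?R" "irreflp_on ?S ?R"
    using assms(2,3) by (auto intro!: transp_onI irreflp_onI dest: transpD irreflpD)
  moreover have "totalp_on ?S ?R"
  proof (rule totalp_onI)
    fix p q assume p: "p \<in> ?S" and q: "q \<in> ?S" and ne: "p \<noteq> q"
    have "P (snd p)" "P (snd q)" using p q by auto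
    moreover have "(content s (snd p), component (snd p)) \<noteq> (content s (snd q), component (snd q))"
      using tagged_node_unique[OF L, of "fst p" "snd p" "fst q" "snd q" s] p q ne
      by (cases p; cases q) auto
    ultimately show "?R p q \<or> ?R q p" by (rule total)
  qed
  ultimately have "\<exists>!w. sorted_wrt ?R w \<and> set w = ?S" by (rule ex1_sorted_wrt)
  from theI'[OF this] show "sorted_wrt ?R (signature_word before P L)"
    "set (signature_word before P L) = ?S" by (simp_all add: signature_word_def)
qed

lemma signature_word_affine:
  assumes "L \<in> multipartitions (length s)"
  shows "sorted_wrt (\<lambda>x y. node_less s (snd y) (snd x)) (signature_word (\<lambda>\<gamma> \<delta>. node_less s \<delta> \<gamma>) P L)"
    and "set (signature_word (\<lambda>\<gamma> \<delta>. node_less s \<delta> \<gamma>) P L) =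
      {(Addable, \<gamma>) |\<gamma>. addable L \<gamma> \<and> P \<gamma>} \<union> {(Removable, \<gamma>) |\<gamma>. removable L \<gamma> \<and> P \<gamma>}"
proof -
  have tr: "transp (\<lambda>\<gamma> \<delta>. node_less s \<delta> \<gamma>)" by (rule transpI) (auto simp: node_less_def)
  have ir: "irreflp (\<lambda>\<gamma> \<delta>. node_less s \<delta> \<gamma>)" by (rule irreflpI) (auto simp: node_less_def)
  have tot: "node_less s \<delta> \<gamma> \<or> node_less s \<gamma> \<delta>"
    if "(content s \<gamma>, component \<gamma>) \<noteq> (content s \<delta>, component \<delta>)" for \<gamma> \<delta>
    using that by (auto simp: node_less_def)
  show "sorted_wrt (\<lambda>x y. node_less s (snd y) (snd x)) (signature_word (\<lambda>\<gamma> \<delta>. node_less s \<delta> \<gamma>) P L)"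
    by (rule signature_word(1)[OF assms tr ir tot])
  show "set (signature_word (\<lambda>\<gamma> \<delta>. node_less s \<delta> \<gamma>) P L) =
      {(Addable, \<gamma>) |\<gamma>. addable L \<gamma> \<and> P \<gamma>} \<union> {(Removable, \<gamma>) |\<gamma>. removable L \<gamma> \<and> P \<gamma>}"
    by (rule signature_word(2)[OF assms tr ir tot])
qed

lemma signature_word_tensor:
  fixes k l j :: int
  assumes "\<mu> \<in> partitions" "\<nu> \<in> partitions"
  defines "w \<equiv> signature_word (\<lambda>\<gamma> \<delta>. component \<gamma> < component \<delta>) (\<lambda>\<gamma>. content [k, l] \<gamma> = j) [\<mu>, \<nu>]"
  shows "sorted_wrt (\<lambda>x y. component (snd x) < component (snd y)) w"
    and "set w = {(Addable, \<gamma>) |\<gamma>. addable [\<mu>, \<nu>] \<gamma> \<and> content [k, l] \<gamma> = j} \<union>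
      {(Removable, \<gamma>) |\<gamma>. removable [\<mu>, \<nu>] \<gamma> \<and> content [k, l] \<gamma> = j}"
proof -
  have L: "[\<mu>, \<nu>] \<in> multipartitions 2" using assms(1,2) by (simp add: multipartitions_def)
  have tr: "transp (\<lambda>\<gamma> \<delta>. component \<gamma> < component \<delta>)" by (rule transpI) auto
  have ir: "irreflp (\<lambda>\<gamma> \<delta>. component \<gamma> < component \<delta>)" by (rule irreflpI) auto
  have tot: "component \<gamma> < component \<delta> \<or> component \<delta> < component \<gamma>"
    if "content [k, l] \<gamma> = j" "content [k, l] \<delta> = j"
      "(content [k, l] \<gamma>, component \<gamma>) \<noteq> (content [k, l] \<delta>, component \<delta>)" for \<gamma> \<delta>
    using that by auto
  show "sorted_wrt (\<lambda>x y. component (snd x) < component (snd y)) w"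
    unfolding w_def by (rule signature_word(1)[OF L tr ir tot])
  show "set w = {(Addable, \<gamma>) |\<gamma>. addable [\<mu>, \<nu>] \<gamma> \<and> content [k, l] \<gamma> = j} \<union>
      {(Removable, \<gamma>) |\<gamma>. removable [\<mu>, \<nu>] \<gamma> \<and> content [k, l] \<gamma> = j}"
    unfolding w_def by (rule signature_word(2)[OF L tr ir tot])
qed

end

(* The signature word of residue r is the concatenation, over the contents congruent to r in decreasing
   order, of three blocks: the nodes in components above i, those in components i and i - 1, and those
   below. The middle block is the word of content c of the tensor product of the components i and i - 1.
   Replacing this pair by its image under psi preserves the number of uncancelled letters of each middle
   block, since that number is determined by the crystal operators, and leaves the other blocks
   unchanged. Hence the rightmost uncancelled A lies in corresponding blocks before and after, and the
   replacement Phi commutes with the arrows. Sigma and Phi both fix the empty multipartition, and since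
   arrows are deterministic in both directions, they agree on its connected component. *)

theory Submission
  imports Defs
begin

section \<open>Uncancelled letters\<close>

text \<open>The isomorphism \<psi> commutes with the operators but may move nodes between the two
  factors, so corresponding words cannot be matched letter by letter. What can be matched, block by
  block, is how many A and R survive. The R's left over from earlier blocks delete A's from the
  front of a block, so a block that keeps any A keeps its last one, and the counts alone decide
  which block holds the good node. Counts are controlled by the operators because an operator flips
  exactly one letter of the word on which it acts: adding a node changes the status only of that
  node and of its neighbours, whose contents differ from its own by one. Hence the recurring
  condition that no two contents read in one word differ by one; for residues this is where e >= 2
  enters. Fixing the empty vertex takes an argument on both sides. For \<Sigma>, the number of nodes
  grades the connected crystal. For \<psi>, the tensor product is not connected and has further
  vertices on which every e operator vanishes; their surviving A's tell them apart from the empty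
  pair.\<close>

definition uncancelled :: "letter \<Rightarrow> (letter \<times> node) list \<Rightarrow> node list" where
  "uncancelled x w = map snd (filter (\<lambda>y. fst y = x) (cancel w))"

lemma remaining_eq_uncancelled:
  "remaining x before P L = uncancelled x (signature_word before P L)"
  by (simp add: remaining_def uncancelled_def reduced_word_eq_cancel)

text \<open>A new leading R meets the leftmost A of the normal form to its right and cancels it,
  hence \<open>tl\<close>; if there is no such A, \<open>tl [] = []\<close> gives the correct value
  and the R joins the front of the surviving R's.\<close>

lemma uncancelled_simps [simp]:
  "uncancelled x [] = []"
  "uncancelled Addable ((Addable, \<gamma>) # w) = \<gamma> # uncancelled Addable w"
  "uncancelled Removable ((Addable, \<gamma>) # w) = uncancelled Removable w"
  "uncancelled Addable ((Removable, \<gamma>) # w) = tl (uncancelled Addable w)"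
  "uncancelled Removable ((Removable, \<gamma>) # w) =
    (if uncancelled Addable w = [] then \<gamma> # uncancelled Removable w else uncancelled Removable w)"
proof -
  obtain p q where pq: "map fst (cancel w) = replicate p Addable @ replicate q Removable"
    using cancel_normal by blast
  show "uncancelled x [] = []" by (simp add: uncancelled_def)
  show "uncancelled Addable ((Addable, \<gamma>) # w) = \<gamma> # uncancelled Addable w"
    and "uncancelled Removable ((Addable, \<gamma>) # w) = uncancelled Removable w"
    by (auto simp: uncancelled_def split: list.split)
  have none: "filter (\<lambda>y. fst y = Addable) w' = []"
    if "map fst w' = replicate n Removable" for w' :: "(letter \<times> node) list" and n
    using that by (induction w' arbitrary: n) (auto simp: Cons_replicate_eq)
  show "uncancelled Addable ((Removable, \<gamma>) # w) = tl (uncancelled Addable w)"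
  proof (cases p)
    case 0
    then show ?thesis using none[of "cancel w" q] pq
      by (cases "cancel w"; cases q) (auto simp: uncancelled_def)
  next
    case (Suc p')
    then show ?thesis using pq by (cases "cancel w") (auto simp: uncancelled_def)
  qed
  show "uncancelled Removable ((Removable, \<gamma>) # w) =
    (if uncancelled Addable w = [] then \<gamma> # uncancelled Removable w else uncancelled Removable w)"
  proof (cases p)
    case 0
    then show ?thesis using none[of "cancel w" q] pq
      by (cases "cancel w"; cases q) (auto simp: uncancelled_def)
  next
    case (Suc p')
    then show ?thesis using pq by (cases "cancel w") (auto simp: uncancelled_def)
  qed
qed

lemma letter_word_induct [case_names Nil Addable Removable]:
  assumes "P []" "\<And>\<gamma> w. P w \<Longrightarrow> P ((Addable, \<gamma>) # w)" "\<And>\<gamma> w. P w \<Longrightarrow> P ((Removable, \<gamma>) # w)"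
  shows "P w"
proof (induction w)
  case (Cons x w)
  then show ?case using assms(2,3) by (cases x; cases "fst x") auto
qed (rule assms(1))

text \<open>Only the R's surviving in \<open>u\<close> and the A's surviving in \<open>v\<close> can
  still meet, and they cancel from the inside out: the rightmost R's of \<open>u\<close> against the
  leftmost A's of \<open>v\<close>. Truncated subtraction covers the case of more A's than
  R's.\<close>

lemma uncancelled_append:
  "uncancelled Addable (u @ v) =
     uncancelled Addable u @ drop (length (uncancelled Removable u)) (uncancelled Addable v)"
  "uncancelled Removable (u @ v) =
     take (length (uncancelled Removable u) - length (uncancelled Addable v)) (uncancelled Removable u)
       @ uncancelled Removable v"
proof (induction u rule: letter_word_induct)
  case (Removable \<gamma> w)
  {
    case 1
    show ?case using Removable by (auto simp: drop_Suc tl_drop)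
  next
    case 2
    show ?case using Removable by (auto simp: Suc_diff_le not_le)
  }
qed simp_all

lemma set_uncancelled: "\<gamma> \<in> set (uncancelled x w) \<Longrightarrow> (x, \<gamma>) \<in> set w"
proof -
  have "set (cancel w) \<subseteq> set w"
    by (induction w) (auto split: list.splits if_splits)
  then show "\<gamma> \<in> set (uncancelled x w) \<Longrightarrow> (x, \<gamma>) \<in> set w"
    by (auto simp: uncancelled_def)
qed

lemma uncancelled_map:
  "uncancelled x (map (map_prod id f) w) = map f (uncancelled x w)"
proof -
  have "cancel (map (map_prod id f) w) = map (map_prod id f) (cancel w)"
    by (induction w) (auto split: list.split)
  then show ?thesis by (simp add: uncancelled_def filter_map comp_def)
qed

text \<open>In this form no R from the left and no A from the right reaches the distinguished
  letter, so it can be flipped without disturbing any other cancellation;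
  \<open>uncancelled_switch\<close> exploits exactly this.\<close>

lemma split_last_uncancelled_Addable:
  assumes "uncancelled Addable w \<noteq> []"
  obtains u v where "w = u @ (Addable, last (uncancelled Addable w)) # v"
    "uncancelled Removable u = []" "uncancelled Addable v = []"
  using assms
proof (induction w arbitrary: thesis rule: letter_word_induct)
  case (Addable \<gamma> w)
  show ?case
  proof (cases "uncancelled Addable w = []")
    case True
    then show ?thesis using Addable.prems(1)[of "[]" w] by simp
  next
    case False
    then obtain u v where "w = u @ (Addable, last (uncancelled Addable w)) # v"
      "uncancelled Removable u = []" "uncancelled Addable v = []"
      using Addable.IH by blast
    then show ?thesis using Addable.prems(1)[of "(Addable, \<gamma>) # u" v] False by simp
  qed
next
  case (Removable \<gamma> w)
  then have ne: "uncancelled Addable w \<noteq> []" "tl (uncancelled Addable w) \<noteq> []" by auto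
  then obtain u v where uv: "w = u @ (Addable, last (uncancelled Addable w)) # v"
      "uncancelled Removable u = []" "uncancelled Addable v = []"
    using Removable.IH by blast
  \<comment> \<open>A second surviving A exists and must come from \<open>u\<close>. The new leading
    R is therefore absorbed inside \<open>u\<close>, which still leaves no surviving R.\<close>
  then have "uncancelled Addable w = uncancelled Addable u @ [last (uncancelled Addable w)]"
    by (metis append_Nil drop0 length_0_conv list.size(3) uncancelled_append(1) uncancelled_simps(2))
  then have "uncancelled Addable u \<noteq> []" using ne(2) by (metis append_Nil list.sel(3))
  then show ?case using Removable.prems(1)[of "(Removable, \<gamma>) # u" v] uv ne
    by (simp add: last_tl)
qed simp

lemma split_hd_uncancelled_Removable:
  assumes "uncancelled Removable w \<noteq> []"
  obtains u v where "w = u @ (Removable, hd (uncancelled Removable w)) # v"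
    "uncancelled Removable u = []" "uncancelled Addable v = []"
  using assms
proof (induction w arbitrary: thesis rule: letter_word_induct)
  case (Addable \<gamma> w)
  then obtain u v where "w = u @ (Removable, hd (uncancelled Removable w)) # v"
    "uncancelled Removable u = []" "uncancelled Addable v = []"
    by auto
  then show ?case using Addable.prems(1)[of "(Addable, \<gamma>) # u" v] by simp
next
  case (Removable \<gamma> w)
  show ?case
  proof (cases "uncancelled Addable w = []")
    case True
    then show ?thesis using Removable.prems(1)[of "[]" w] by simp
  next
    case False
    then have "uncancelled Removable w \<noteq> []" using Removable.prems(2) by auto
    then obtain u v where uv: "w = u @ (Removable, hd (uncancelled Removable w)) # v"
        "uncancelled Removable u = []" "uncancelled Addable v = []"
      using Removable.IH by blast
    \<comment> \<open>The letter R and the word \<open>v\<close> behind it supply no surviving A, so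
      the A consumed by the new leading R lies in \<open>u\<close>.\<close>
    then have "uncancelled Addable w = uncancelled Addable u"
      by (metis append_Nil2 drop_Nil tl_Nil uncancelled_append(1) uncancelled_simps(4))
    then show ?thesis using Removable.prems(1)[of "(Removable, \<gamma>) # u" v] uv False by simp
  qed
qed simp

lemma uncancelled_switch:
  assumes "uncancelled Removable u = []" "uncancelled Addable v = []"
  shows "uncancelled Addable (u @ (Addable, \<gamma>) # v) = uncancelled Addable u @ [\<gamma>]"
    "uncancelled Removable (u @ (Addable, \<gamma>) # v) = uncancelled Removable v"
    "uncancelled Addable (u @ (Removable, \<gamma>) # v) = uncancelled Addable u"
    "uncancelled Removable (u @ (Removable, \<gamma>) # v) = \<gamma> # uncancelled Removable v"
  using assms by (simp_all add: uncancelled_append)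

text \<open>By \<open>uncancelled_append\<close>, what precedes a block can only delete an initial
  segment of its surviving A's, so the last survivor of the concatenation is the last survivor of a
  single block. Which block that is depends on the counts alone, so both lists select the same
  position.\<close>

lemma last_uncancelled_concat:
  assumes "list_all2 (\<lambda>w w'. \<forall>x. length (uncancelled x w) = length (uncancelled x w')) ws ws'"
  shows "(\<forall>x. length (uncancelled x (concat ws)) = length (uncancelled x (concat ws'))) \<and>
    (uncancelled Addable (concat ws) \<noteq> [] \<longrightarrow>
      (\<exists>(w, w') \<in> set (zip ws ws'). uncancelled Addable w \<noteq> [] \<and>
         last (uncancelled Addable (concat ws)) = last (uncancelled Addable w) \<and>
         last (uncancelled Addable (concat ws')) = last (uncancelled Addable w')))"
  using assms
proof (induction rule: list_all2_induct)
  case (Cons w ws w' ws')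
  let ?n = "length (uncancelled Removable w)"
  have len: "length (uncancelled x w) = length (uncancelled x w')"
    "length (uncancelled x (concat ws)) = length (uncancelled x (concat ws'))" for x
    using Cons by auto
  have "length (uncancelled x (concat (w # ws))) = length (uncancelled x (concat (w' # ws')))" for x
    by (cases x) (simp_all add: uncancelled_append len)
  moreover have "\<exists>(v, v') \<in> set (zip (w # ws) (w' # ws')). uncancelled Addable v \<noteq> [] \<and>
         last (uncancelled Addable (concat (w # ws))) = last (uncancelled Addable v) \<and>
         last (uncancelled Addable (concat (w' # ws'))) = last (uncancelled Addable v')"
    if ne: "uncancelled Addable (concat (w # ws)) \<noteq> []"
  \<comment> \<open>Either the R's of \<open>w\<close> leave an A of the tail, which the induction
    hypothesis locates, or they consume all of them and the last A is that of
    \<open>w\<close>.\<close>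
  proof (cases "?n < length (uncancelled Addable (concat ws))")
    case True
    then have "uncancelled Addable (concat ws) \<noteq> []" by auto
    moreover have "last (uncancelled Addable (concat (w # ws))) = last (uncancelled Addable (concat ws))"
      using True by (simp add: uncancelled_append)
    moreover have "last (uncancelled Addable (concat (w' # ws'))) = last (uncancelled Addable (concat ws'))"
      using True by (simp add: uncancelled_append len)
    ultimately show ?thesis using Cons.IH by fastforce
  next
    case False
    then show ?thesis using ne by (auto simp: uncancelled_append len)
  qed
  ultimately show ?case by blast
qed simp

text \<open>Totality on the entries is read off from a sorted list, in which any two distinct
  entries are comparable.\<close>

lemma sorted_wrt_unique:
  assumes "transp R" "irreflp R" "sorted_wrt R w" "sorted_wrt R w'" "set w = set w'"
  shows "w = w'"
proof -
  have tot: "x = y \<or> R x y \<or> R y x" if "sorted_wrt R v" "x \<in> set v" "y \<in> set v" for v x y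
    using that by (induction v) auto
  have "totalp_on (set w) R" using tot[OF assms(3)] by (auto intro: totalp_onI)
  moreover have "transp_on (set w) R" "irreflp_on (set w) R"
    using assms(1,2) by (auto intro: transp_on_subset irreflp_on_subset)
  ultimately show ?thesis using ex1_sorted_wrt[of "set w" R] assms(3-5) by auto
qed

lemma sorted_wrt_concat_map:
  assumes "sorted_wrt S cs" "\<And>c. c \<in> set cs \<Longrightarrow> sorted_wrt R (B c)"
    "\<And>c d x y. c \<in> set cs \<Longrightarrow> d \<in> set cs \<Longrightarrow> S c d \<Longrightarrow> x \<in> set (B c) \<Longrightarrow> y \<in> set (B d) \<Longrightarrow> R x y"
  shows "sorted_wrt R (concat (map B cs))"
  using assms
proof (induction cs)
  case (Cons c cs)
  have "R x y" if "d \<in> set cs" "d' \<in> set cs" "S d d'" "x \<in> set (B d)" "y \<in> set (B d')" for d d' x y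
    using that by (intro Cons.prems(3)[of d d']) auto
  then have "sorted_wrt R (concat (map B cs))"
    using Cons.prems(1,2) by (intro Cons.IH) auto
  then show ?case using Cons.prems by (fastforce simp: sorted_wrt_append)
qed simp

section \<open>Adding and removing nodes\<close>

lemma downward_closed_eq_atLeastAtMost:
  assumes "finite S" "0 \<notin> S" "\<And>x y. x \<in> S \<Longrightarrow> 1 \<le> y \<Longrightarrow> y \<le> x \<Longrightarrow> y \<in> S"
  shows "S = {1..card S}"
proof (cases "S = {}")
  case False
  define m where "m = Max S"
  have "y \<in> S" if "1 \<le> y" "y \<le> m" for y
    using assms(3)[OF Max_in[OF assms(1) False] that(1)] that(2) m_def by simp
  moreover have "1 \<le> y \<and> y \<le> m" if "y \<in> S" for y
    using that assms(1,2) m_def by (cases y) auto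
  ultimately have S: "S = {1..m}" unfolding set_eq_iff atLeastAtMost_iff by blast
  have "card S = m" by (subst S) simp
  with S show ?thesis by metis
qed simp

text \<open>By downward closure every row and every first column is an initial interval, so row
  lengths and heights can be taken as cardinalities. This supplies the witness demanded by the
  definitions of \<open>addable\<close> and \<open>removable\<close> and turns them into conditions
  on neighbouring boxes.\<close>

lemma ex_multipartition_nodes:
  assumes fin: "finite D"
    and pos: "\<And>a b c. (a, b, c) \<in> D \<Longrightarrow> 1 \<le> a \<and> 1 \<le> b \<and> c < l"
    and down: "\<And>a b c a' b'. (a, b, c) \<in> D \<Longrightarrow> 1 \<le> a' \<Longrightarrow> a' \<le> a \<Longrightarrow> 1 \<le> b' \<Longrightarrow> b' \<le> b \<Longrightarrow>
      (a', b', c) \<in> D"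
  shows "\<exists>M \<in> multipartitions l. nodes M = D"
proof -
  define row where "row a c = card {b. (a, b, c) \<in> D}" for a c
  define height where "height c = card {a. (a, 1, c) \<in> D}" for c
  define M where "M = map (\<lambda>c. map (\<lambda>a. row (Suc a) c) [0..<height c]) [0..<l]"
  have fin_row: "finite {b. (a, b, c) \<in> D}" for a c
    by (rule finite_subset[OF _ finite_imageI[OF fin, of "fst \<circ> snd"]]) force
  have fin_col: "finite {a. (a, 1, c) \<in> D}" for c
    by (rule finite_subset[OF _ finite_imageI[OF fin, of fst]]) force
  have row_eq: "{b. (a, b, c) \<in> D} = {1..row a c}" for a c
    unfolding row_def
  proof (intro downward_closed_eq_atLeastAtMost fin_row)
    show "0 \<notin> {b. (a, b, c) \<in> D}" using pos[of a 0 c] by auto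
    show "y \<in> {b. (a, b, c) \<in> D}" if "x \<in> {b. (a, b, c) \<in> D}" "1 \<le> y" "y \<le> x" for x y
      using down[of a x c a y] pos[of a x c] that by simp
  qed
  have row: "(a, b, c) \<in> D \<longleftrightarrow> 1 \<le> b \<and> b \<le> row a c" for a b c
    using row_eq[of a c] by (simp add: set_eq_iff)
  have height_eq: "{a. (a, 1, c) \<in> D} = {1..height c}" for c
    unfolding height_def
  proof (intro downward_closed_eq_atLeastAtMost fin_col)
    show "0 \<notin> {a. (a, 1, c) \<in> D}" using pos[of 0 1 c] by auto
    show "y \<in> {a. (a, 1, c) \<in> D}" if "x \<in> {a. (a, 1, c) \<in> D}" "1 \<le> y" "y \<le> x" for x y
      using down[of x 1 c y 1] that by simp
  qed
  have height: "(a, 1, c) \<in> D \<longleftrightarrow> 1 \<le> a \<and> a \<le> height c" for a c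
    using height_eq[of c] by (simp add: set_eq_iff)
  have "row (Suc a') c \<le> row (Suc a) c" if "a < a'" for a a' c
    unfolding row_def
  proof (intro card_mono fin_row subsetI)
    fix b assume "b \<in> {b. (Suc a', b, c) \<in> D}"
    then show "b \<in> {b. (Suc a, b, c) \<in> D}"
      using down[of "Suc a'" b c "Suc a" b] pos[of "Suc a'" b c] that by simp
  qed
  moreover have "0 < row (Suc a) c" if "a < height c" for a c
    using that height[of "Suc a" c] row[of "Suc a" 1 c] by auto
  ultimately have "map (\<lambda>a. row (Suc a) c) [0..<height c] \<in> partitions" for c
    by (force simp: partitions_def sorted_wrt_iff_nth_less)
  then have "M \<in> multipartitions l" by (auto simp: multipartitions_def M_def)
  moreover have "(a, b, c) \<in> nodes M \<longleftrightarrow> (a, b, c) \<in> D" for a b c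
  proof -
    have "(a, b, c) \<in> nodes M \<longleftrightarrow> c < l \<and> 1 \<le> a \<and> a \<le> height c \<and> 1 \<le> b \<and> b \<le> row a c"
      by (cases "c < l"; cases a) (auto simp: nodes_def M_def)
    also have "\<dots> \<longleftrightarrow> c < l \<and> (a, 1, c) \<in> D \<and> (a, b, c) \<in> D"
      using row height by blast
    also have "\<dots> \<longleftrightarrow> (a, b, c) \<in> D"
      using pos[of a b c] down[of a b c a 1] by auto
    finally show ?thesis .
  qed
  then have "nodes M = D" by auto
  ultimately show ?thesis by blast
qed

lemma addable_iff:
  assumes L: "L \<in> multipartitions l"
  shows "addable L (a, b, c) \<longleftrightarrow> c < l \<and> 1 \<le> a \<and> 1 \<le> b \<and> (a, b, c) \<notin> nodes L \<and>
    (a = 1 \<or> (a - 1, b, c) \<in> nodes L) \<and> (b = 1 \<or> (a, b - 1, c) \<in> nodes L)"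
    (is "_ \<longleftrightarrow> ?rhs")
proof
  have len: "length L = l" using L by (simp add: multipartitions_def)
  assume add: "addable L (a, b, c)"
  have pos: "1 \<le> a" "1 \<le> b" "c < l" using addable_pos[OF add] len by auto
  have "(a - 1, b, c) \<in> nodes L" if "a \<noteq> 1"
    using that pos by (intro addable_downward[OF add]) auto
  moreover have "(a, b - 1, c) \<in> nodes L" if "b \<noteq> 1"
    using that pos by (intro addable_downward[OF add]) auto
  ultimately show ?rhs using pos add by (auto simp: addable_def)
next
  have len: "length L = l" using L by (simp add: multipartitions_def)
  assume r: ?rhs
  have "\<exists>M \<in> multipartitions l. nodes M = insert (a, b, c) (nodes L)"
  proof (rule ex_multipartition_nodes)
    show "finite (insert (a, b, c) (nodes L))" by (simp add: finite_nodes)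
    show "1 \<le> x \<and> 1 \<le> y \<and> z < l" if "(x, y, z) \<in> insert (a, b, c) (nodes L)" for x y z
      using that r nodes_pos[of x y z L] len by auto
    show "(x', y', z) \<in> insert (a, b, c) (nodes L)"
      if "(x, y, z) \<in> insert (a, b, c) (nodes L)" "1 \<le> x'" "x' \<le> x" "1 \<le> y'" "y' \<le> y" for x y z x' y'
    proof (cases "(x, y, z) = (a, b, c)")
      case True
      have "x' = a \<and> y' = b \<or> x' < a \<or> y' < b" using that True by auto
      then consider "x' = a" "y' = b" | "x' < a" | "y' < b" by blast
      then show ?thesis
      proof cases
        case 2
        then have "(a - 1, b, c) \<in> nodes L" using that r by auto
        from nodes_downward[OF L this, of x' y'] show ?thesis using that True 2 by auto
      next
        case 3
        then have "(a, b - 1, c) \<in> nodes L" using that r by auto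
        from nodes_downward[OF L this, of x' y'] show ?thesis using that True 3 by auto
      qed (use True in auto)
    next
      case False
      then show ?thesis using that nodes_downward[OF L, of x y z x' y'] by auto
    qed
  qed
  then show "addable L (a, b, c)" using r len by (simp add: addable_def)
qed

lemma removable_iff:
  assumes L: "L \<in> multipartitions l"
  shows "removable L (a, b, c) \<longleftrightarrow>
    (a, b, c) \<in> nodes L \<and> (Suc a, b, c) \<notin> nodes L \<and> (a, Suc b, c) \<notin> nodes L"
    (is "_ \<longleftrightarrow> ?rhs")
proof
  assume rem: "removable L (a, b, c)"
  then show ?rhs using removable_maximal[OF rem, of "Suc a" b] removable_maximal[OF rem, of a "Suc b"]
    by (auto simp: removable_def)
next
  have len: "length L = l" using L by (simp add: multipartitions_def)
  assume r: ?rhs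
  have "\<exists>M \<in> multipartitions l. nodes M = nodes L - {(a, b, c)}"
  proof (rule ex_multipartition_nodes)
    show "finite (nodes L - {(a, b, c)})" by (simp add: finite_nodes)
    show "1 \<le> x \<and> 1 \<le> y \<and> z < l" if "(x, y, z) \<in> nodes L - {(a, b, c)}" for x y z
      using that nodes_pos[of x y z L] len by auto
    show "(x', y', z) \<in> nodes L - {(a, b, c)}"
      if "(x, y, z) \<in> nodes L - {(a, b, c)}" "1 \<le> x'" "x' \<le> x" "1 \<le> y'" "y' \<le> y" for x y z x' y'
    proof -
      have "(x', y', z) \<noteq> (a, b, c)"
      proof
        assume eq: "(x', y', z) = (a, b, c)"
        \<comment> \<open>A surviving box that dominates the removed one, but differs from it,
          dominates the box directly below it or directly to its right, and neither of these belongs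
          to \<open>L\<close>.\<close>
        then have "Suc a \<le> x \<or> Suc b \<le> y" using that by fastforce
        then show False
          using that r eq nodes_downward[OF L, of x y z "Suc a" b] nodes_downward[OF L, of x y z a "Suc b"]
          by auto
      qed
      then show ?thesis using that nodes_downward[OF L, of x y z x' y'] by auto
    qed
  qed
  then show "removable L (a, b, c)" using r len by (simp add: removable_def)
qed

text \<open>The status of a box depends only on the box and its four neighbours, and the contents of
  neighbours differ by one. A box at content distance other than one from \<gamma> can therefore
  notice the addition of \<gamma> only if it is \<gamma> itself.\<close>

lemma add_node_switch:
  assumes L: "L \<in> multipartitions l" and add: "addable L \<gamma>"
    and nadj: "\<delta> \<noteq> \<gamma> \<Longrightarrow> \<bar>content s \<delta> - content s \<gamma>\<bar> \<noteq> 1"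
  shows "addable (add_node L \<gamma>) \<delta> \<longleftrightarrow> \<delta> \<noteq> \<gamma> \<and> addable L \<delta>"
    and "removable (add_node L \<gamma>) \<delta> \<longleftrightarrow> \<delta> = \<gamma> \<or> removable L \<delta>"
proof -
  obtain a b c where \<gamma>: "\<gamma> = (a, b, c)" by (cases \<gamma>)
  obtain x y z where \<delta>: "\<delta> = (x, y, z)" by (cases \<delta>)
  have len: "length L = l" using L by (simp add: multipartitions_def)
  note M = add_node[OF add, unfolded len]
  have \<gamma>L: "(a, b, c) \<notin> nodes L" using add \<gamma> by (simp add: addable_def)
  have up: "(Suc a, b, c) \<notin> nodes L" "(a, Suc b, c) \<notin> nodes L"
    using nodes_downward[OF L, of "Suc a" b c a b] nodes_downward[OF L, of a "Suc b" c a b]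
      \<gamma>L addable_pos[OF add[unfolded \<gamma>]] by auto
  show "addable (add_node L \<gamma>) \<delta> \<longleftrightarrow> \<delta> \<noteq> \<gamma> \<and> addable L \<delta>"
  proof (cases "\<delta> = \<gamma>")
    case True
    then show ?thesis using M by (simp add: addable_def)
  next
    case False
    then have "(x - 1, y, z) \<noteq> (a, b, c)" if "1 \<le> x" using that nadj \<gamma> \<delta> by (auto simp: content_def)
    moreover have "(x, y - 1, z) \<noteq> (a, b, c)" if "1 \<le> y"
      using that False nadj \<gamma> \<delta> by (auto simp: content_def)
    ultimately show ?thesis using False unfolding \<delta> addable_iff[OF L] addable_iff[OF M(1)] M(2)
      by (auto simp: \<gamma>)
  qed
  show "removable (add_node L \<gamma>) \<delta> \<longleftrightarrow> \<delta> = \<gamma> \<or> removable L \<delta>"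
  proof (cases "\<delta> = \<gamma>")
    case True
    then show ?thesis using up unfolding \<delta> removable_iff[OF M(1)] M(2) by (auto simp: \<gamma>)
  next
    case False
    then have "(Suc x, y, z) \<noteq> (a, b, c)" "(x, Suc y, z) \<noteq> (a, b, c)"
      using nadj \<gamma> \<delta> by (auto simp: content_def)
    then show ?thesis using False unfolding \<delta> removable_iff[OF L] removable_iff[OF M(1)] M(2)
      by (auto simp: \<gamma>)
  qed
qed

lemma remove_node_addable:
  assumes L: "L \<in> multipartitions l" and rem: "removable L \<gamma>"
  shows "addable (remove_node L \<gamma>) \<gamma>" "add_node (remove_node L \<gamma>) \<gamma> = L"
proof -
  have len: "length L = l" using L by (simp add: multipartitions_def)
  note M = remove_node[OF rem, unfolded len]
  have lenM: "length (remove_node L \<gamma>) = l" using M(1) by (simp add: multipartitions_def)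
  have nodes_L: "nodes L = insert \<gamma> (nodes (remove_node L \<gamma>))" using M rem by (auto simp: removable_def)
  then show add: "addable (remove_node L \<gamma>) \<gamma>" using L M lenM by (auto simp: addable_def)
  show "add_node (remove_node L \<gamma>) \<gamma> = L"
    using add_node[OF add, unfolded lenM] L nodes_L by (intro inj_onD[OF inj_on_nodes]) auto
qed

text \<open>Common ground of the affine reading of a residue class and of the tensor product reading
  of one exact content. \<open>total\<close> suffices for listing the letters because a component
  has at most one addable or removable node of each content; \<open>separated\<close> makes an
  operator flip a single letter.\<close>

locale node_order =
  fixes s :: "int list" and before :: "node \<Rightarrow> node \<Rightarrow> bool" and P :: "node \<Rightarrow> bool"
  assumes trans: "transp before" and irrefl: "irreflp before"
    and total: "\<And>\<gamma> \<delta>. P \<gamma> \<Longrightarrow> P \<delta> \<Longrightarrow> (content s \<gamma>, component \<gamma>) \<noteq> (content s \<delta>, component \<delta>) \<Longrightarrow>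
      before \<gamma> \<delta> \<or> before \<delta> \<gamma>"
    and separated: "\<And>\<gamma> \<delta>. P \<gamma> \<Longrightarrow> P \<delta> \<Longrightarrow> \<bar>content s \<delta> - content s \<gamma>\<bar> \<noteq> 1"
begin

lemma word_unique:
  assumes "sorted_wrt (\<lambda>x y. before (snd x) (snd y)) w"
    "sorted_wrt (\<lambda>x y. before (snd x) (snd y)) w'" "set w = set w'"
  shows "w = w'"
proof (rule sorted_wrt_unique[OF _ _ assms])
  show "transp (\<lambda>x y. before (snd x) (snd y))"
    using trans by (auto intro!: transpI dest: transpD)
  show "irreflp (\<lambda>x y. before (snd x) (snd y))"
    using irrefl by (auto intro!: irreflpI dest: irreflpD)
qed

lemma set_signature_word:
  "L \<in> multipartitions l \<Longrightarrow> set (signature_word before P L) =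
    {(Addable, \<gamma>) |\<gamma>. addable L \<gamma> \<and> P \<gamma>} \<union> {(Removable, \<gamma>) |\<gamma>. removable L \<gamma> \<and> P \<gamma>}"
  by (rule signature_word(2)[OF _ trans irrefl total])

lemma sorted_signature_word:
  "L \<in> multipartitions l \<Longrightarrow>
    sorted_wrt (\<lambda>x y. before (snd x) (snd y)) (signature_word before P L)"
  by (rule signature_word(1)[OF _ trans irrefl total])

text \<open>Both directions are treated at once: for x = A the word of \<open>L\<close> determines
  that of \<open>M\<close>, for x = R the word of \<open>M\<close> determines that of
  \<open>L\<close>. The flipped letter keeps its position since the order looks at nodes
  only.\<close>

lemma signature_word_switch:
  assumes L: "L \<in> multipartitions l" and M: "M \<in> multipartitions l"
    and add: "addable L \<gamma>" "M = add_node L \<gamma>" and "P \<gamma>" "{x, y} = {Addable, Removable}"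
    and "(x, \<gamma>) \<in> set (signature_word before P (if x = Addable then L else M))"
    and w: "signature_word before P (if x = Addable then L else M) = u @ (x, \<gamma>) # v"
  shows "signature_word before P (if x = Addable then M else L) = u @ (y, \<gamma>) # v"
proof (rule word_unique)
  let ?K = "if x = Addable then L else M" and ?N = "if x = Addable then M else L"
  have KN: "?K \<in> multipartitions l" "?N \<in> multipartitions l" using L M by auto
  show "sorted_wrt (\<lambda>x y. before (snd x) (snd y)) (signature_word before P ?N)"
    by (rule sorted_signature_word[OF KN(2)])
  have sorted: "sorted_wrt (\<lambda>x y. before (snd x) (snd y)) (u @ (x, \<gamma>) # v)"
    using sorted_signature_word[OF KN(1)] w by simp
  then show "sorted_wrt (\<lambda>x y. before (snd x) (snd y)) (u @ (y, \<gamma>) # v)"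
    by (simp add: sorted_wrt_append)
  \<comment> \<open>Strictness of the order leaves no second letter at \<gamma>, so replacing this
    one position changes the set of letters exactly at \<gamma>.\<close>
  have "\<not> before \<gamma> \<gamma>" using irrefl by (simp add: irreflpD)
  then have uv: "(z, \<gamma>) \<notin> set u \<union> set v" for z
    using sorted by (fastforce simp: sorted_wrt_append)
  have sep: "\<bar>content s \<delta> - content s \<gamma>\<bar> \<noteq> 1" if "P \<delta>" for \<delta>
    using separated that \<open>P \<gamma>\<close> by blast
  have iff: "addable M \<delta> \<longleftrightarrow> \<delta> \<noteq> \<gamma> \<and> addable L \<delta>" "removable M \<delta> \<longleftrightarrow> \<delta> = \<gamma> \<or> removable L \<delta>"
    if "P \<delta>" for \<delta>
    using add_node_switch[OF L add(1), of \<delta> s] sep[OF that] add(2) by auto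
  have "\<not> removable L \<gamma>" using add(1) by (auto simp: addable_def removable_def)
  then have eq: "(z, \<delta>) \<in> set (signature_word before P ?N) \<longleftrightarrow>
      (z, \<delta>) \<in> set (signature_word before P ?K) \<and> \<delta> \<noteq> \<gamma> \<or> (z, \<delta>) = (y, \<gamma>)" for z \<delta>
    using assms(6) iff[of \<delta>] \<open>P \<gamma>\<close> add(1)
    by (cases z; cases \<gamma>; cases \<delta>)
      (auto simp: set_signature_word[OF L] set_signature_word[OF M] doubleton_eq_iff)
  show "set (signature_word before P ?N) = set (u @ (y, \<gamma>) # v)"
    using eq uv unfolding w by auto
qed

text \<open>The flipped letter passes from the end of the surviving A's to the front of the
  surviving R's. The drop of the A count drives the invariance proof for \<psi>, the new head of the
  R's drives injectivity.\<close>

lemma f_op_Some: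
  assumes L: "L \<in> multipartitions l" and f: "f_op before P L = Some M"
  obtains \<gamma> where "addable L \<gamma>" "P \<gamma>" "M = add_node L \<gamma>" "M \<in> multipartitions l"
    "remaining Addable before P L = remaining Addable before P M @ [\<gamma>]"
    "remaining Removable before P M = \<gamma> # remaining Removable before P L"
proof -
  have len: "length L = l" using L by (simp add: multipartitions_def)
  define w where "w = signature_word before P L"
  define \<gamma> where "\<gamma> = last (uncancelled Addable w)"
  have ne: "uncancelled Addable w \<noteq> []" and M: "M = add_node L \<gamma>"
    using f by (auto simp: f_op_def remaining_eq_uncancelled w_def \<gamma>_def Let_def split: if_splits)
  obtain u v where uv: "w = u @ (Addable, \<gamma>) # v"
    "uncancelled Removable u = []" "uncancelled Addable v = []"
    unfolding \<gamma>_def by (rule split_last_uncancelled_Addable[OF ne])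
  then have mem: "(Addable, \<gamma>) \<in> set w" by simp
  then have \<gamma>: "addable L \<gamma>" "P \<gamma>" unfolding w_def set_signature_word[OF L] by auto
  note M' = add_node(1)[OF \<gamma>(1), unfolded len, folded M]
  have "signature_word before P M = u @ (Removable, \<gamma>) # v"
    using signature_word_switch[OF L M' \<gamma>(1) M \<gamma>(2), of Addable Removable u v] mem uv w_def by simp
  then have "uncancelled Addable w = uncancelled Addable (signature_word before P M) @ [\<gamma>]"
    "uncancelled Removable (signature_word before P M) = \<gamma> # uncancelled Removable w"
    using uncancelled_switch[OF uv(2,3)] uv(1) by auto
  then show thesis using that[OF \<gamma> M M'] by (simp add: remaining_eq_uncancelled w_def)
qed

lemma e_op_Some:
  assumes L: "L \<in> multipartitions l" and e: "e_op before P L = Some M"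
  obtains \<gamma> where "M \<in> multipartitions l"
    "remaining Removable before P L = \<gamma> # remaining Removable before P M"
proof -
  have len: "length L = l" using L by (simp add: multipartitions_def)
  define w where "w = signature_word before P L"
  define \<gamma> where "\<gamma> = hd (uncancelled Removable w)"
  have ne: "uncancelled Removable w \<noteq> []" and M: "M = remove_node L \<gamma>"
    using e by (auto simp: e_op_def remaining_eq_uncancelled w_def \<gamma>_def Let_def split: if_splits)
  obtain u v where uv: "w = u @ (Removable, \<gamma>) # v"
    "uncancelled Removable u = []" "uncancelled Addable v = []"
    unfolding \<gamma>_def by (rule split_hd_uncancelled_Removable[OF ne])
  then have mem: "(Removable, \<gamma>) \<in> set w" by simp
  then have \<gamma>: "removable L \<gamma>" "P \<gamma>" unfolding w_def set_signature_word[OF L] by auto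
  note M' = remove_node(1)[OF \<gamma>(1), unfolded len, folded M]
  note add = remove_node_addable[OF L \<gamma>(1), folded M]
  \<comment> \<open>Since \<open>L\<close> is \<open>M\<close> with \<gamma> added, the switch lemma
    applies with the two multipartitions interchanged.\<close>
  have "signature_word before P M = u @ (Addable, \<gamma>) # v"
    using signature_word_switch[OF M' L add(1) add(2)[symmetric] \<gamma>(2), of Removable Addable u v] mem uv w_def
    by (simp add: insert_commute)
  then have "uncancelled Removable w = \<gamma> # uncancelled Removable (signature_word before P M)"
    using uncancelled_switch[OF uv(2,3)] uv(1) by auto
  then show thesis using that[OF M'] by (simp add: remaining_eq_uncancelled w_def)
qed

text \<open>The added node can be recovered from \<open>M\<close> alone, as its leftmost surviving
  R.\<close>

lemma f_op_inj:
  assumes "L \<in> multipartitions l" "L' \<in> multipartitions l" "f_op before P L = Some M" "f_op before P L' = Some M"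
  shows "L = L'"
proof -
  obtain \<gamma> where \<gamma>: "addable L \<gamma>" "M = add_node L \<gamma>"
      "remaining Removable before P M = \<gamma> # remaining Removable before P L"
    by (rule f_op_Some[OF assms(1,3)], rule that)
  obtain \<delta> where \<delta>: "addable L' \<delta>" "M = add_node L' \<delta>"
      "remaining Removable before P M = \<delta> # remaining Removable before P L'"
    by (rule f_op_Some[OF assms(2,4)], rule that)
  have "\<delta> = \<gamma>" using \<gamma>(3) \<delta>(3) by simp
  then have "insert \<gamma> (nodes L) = insert \<gamma> (nodes L')" "\<gamma> \<notin> nodes L" "\<gamma> \<notin> nodes L'"
    using \<gamma>(1,2) \<delta>(1,2) add_node(2)[OF \<gamma>(1)] add_node(2)[OF \<delta>(1)] by (auto simp: addable_def)
  then have "nodes L = nodes L'" by (simp add: insert_ident)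
  then show ?thesis using assms(1,2) by (intro inj_onD[OF inj_on_nodes])
qed

end

section \<open>Tensor products of two fundamental crystals\<close>

lemma f_op_eq_None_iff: "f_op before P L = None \<longleftrightarrow> remaining Addable before P L = []"
  by (simp add: f_op_def Let_def)

lemma e_op_eq_None_iff: "e_op before P L = None \<longleftrightarrow> remaining Removable before P L = []"
  by (simp add: e_op_def Let_def)

lemma node_order_affine:
  assumes "\<And>\<gamma> \<delta>. P \<gamma> \<Longrightarrow> P \<delta> \<Longrightarrow> \<bar>content s \<delta> - content s \<gamma>\<bar> \<noteq> 1"
  shows "node_order s (\<lambda>\<gamma> \<delta>. node_less s \<delta> \<gamma>) P"
  by standard (use assms in \<open>auto simp: node_less_def intro!: transpI irreflpI\<close>)

lemma node_order_tensor:
  "node_order [k, l] (\<lambda>\<gamma> \<delta>. component \<gamma> < component \<delta>) (\<lambda>\<gamma>. content [k, l] \<gamma> = j)"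
  by standard (auto intro!: transpI irreflpI)

lemma multipartitions_2D:
  assumes "M \<in> multipartitions 2"
  shows "M = [M ! 0, M ! 1]" "(M ! 0, M ! 1) \<in> partitions \<times> partitions"
proof -
  obtain \<mu> \<nu> where "M = [\<mu>, \<nu>]"
    using assms by (auto simp: multipartitions_def numeral_2_eq_2 length_Suc_conv)
  then show "M = [M ! 0, M ! 1]" "(M ! 0, M ! 1) \<in> partitions \<times> partitions"
    using assms by (auto simp: multipartitions_def)
qed

definition tensor_word ::
    "int \<Rightarrow> int \<Rightarrow> int \<Rightarrow> nat list \<times> nat list \<Rightarrow> (letter \<times> node) list" where
  "tensor_word k l j x = signature_word (\<lambda>\<gamma> \<delta>. component \<gamma> < component \<delta>)
     (\<lambda>\<gamma>. content [k, l] \<gamma> = j) [fst x, snd x]"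

lemma tensor_f_cases:
  assumes x: "x \<in> partitions \<times> partitions"
  obtains "tensor_f k l j x = None" "uncancelled Addable (tensor_word k l j x) = []"
  | y where "tensor_f k l j x = Some y" "y \<in> partitions \<times> partitions"
    "length (uncancelled Addable (tensor_word k l j x)) =
      Suc (length (uncancelled Addable (tensor_word k l j y)))"
    "[fst y, snd y] = add_node [fst x, snd x] (last (uncancelled Addable (tensor_word k l j x)))"
    "uncancelled Addable (tensor_word k l j x) \<noteq> []"
proof -
  interpret node_order "[k, l]" "\<lambda>\<gamma> \<delta>. component \<gamma> < component \<delta>" "\<lambda>\<gamma>. content [k, l] \<gamma> = j"
    by (rule node_order_tensor)
  let ?r = "remaining Addable (\<lambda>\<gamma> \<delta>. component \<gamma> < component \<delta>) (\<lambda>\<gamma>. content [k, l] \<gamma> = j)"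
  let ?f = "f_op (\<lambda>\<gamma> \<delta>. component \<gamma> < component \<delta>) (\<lambda>\<gamma>. content [k, l] \<gamma> = j)"
  have L: "[fst x, snd x] \<in> multipartitions 2" using x by (auto simp: multipartitions_def)
  have f: "tensor_f k l j x = map_option (\<lambda>M. (M ! 0, M ! 1)) (?f [fst x, snd x])"
    by (simp add: tensor_f_def split_beta)
  show thesis
  proof (cases "?f [fst x, snd x]")
    case None
    then have "uncancelled Addable (tensor_word k l j x) = []"
      by (simp add: f_op_eq_None_iff remaining_eq_uncancelled tensor_word_def)
    with None f show thesis by (intro that(1)) simp_all
  next
    case (Some M)
    obtain \<gamma> where \<gamma>: "addable [fst x, snd x] \<gamma>" "M = add_node [fst x, snd x] \<gamma>" "M \<in> multipartitions 2"
      "?r [fst x, snd x] = ?r M @ [\<gamma>]"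
      by (rule f_op_Some[OF L Some], rule that)
    note M = multipartitions_2D[OF \<gamma>(3)]
    show thesis
    proof (rule that(2))
      show "tensor_f k l j x = Some (M ! 0, M ! 1)" by (simp add: f Some)
      show "(M ! 0, M ! 1) \<in> partitions \<times> partitions" by (rule M)
    qed (use \<gamma> M(1) in \<open>simp_all add: tensor_word_def remaining_eq_uncancelled\<close>)
  qed
qed

lemma tensor_e_cases:
  assumes x: "x \<in> partitions \<times> partitions"
  obtains "tensor_e k l j x = None" "uncancelled Removable (tensor_word k l j x) = []"
  | y where "tensor_e k l j x = Some y" "y \<in> partitions \<times> partitions"
    "length (uncancelled Removable (tensor_word k l j x)) =
      Suc (length (uncancelled Removable (tensor_word k l j y)))"
proof -
  interpret node_order "[k, l]" "\<lambda>\<gamma> \<delta>. component \<gamma> < component \<delta>" "\<lambda>\<gamma>. content [k, l] \<gamma> = j"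
    by (rule node_order_tensor)
  let ?r = "remaining Removable (\<lambda>\<gamma> \<delta>. component \<gamma> < component \<delta>) (\<lambda>\<gamma>. content [k, l] \<gamma> = j)"
  let ?e = "e_op (\<lambda>\<gamma> \<delta>. component \<gamma> < component \<delta>) (\<lambda>\<gamma>. content [k, l] \<gamma> = j)"
  have L: "[fst x, snd x] \<in> multipartitions 2" using x by (auto simp: multipartitions_def)
  have e: "tensor_e k l j x = map_option (\<lambda>M. (M ! 0, M ! 1)) (?e [fst x, snd x])"
    by (simp add: tensor_e_def split_beta)
  show thesis
  proof (cases "?e [fst x, snd x]")
    case None
    then have "uncancelled Removable (tensor_word k l j x) = []"
      by (simp add: e_op_eq_None_iff remaining_eq_uncancelled tensor_word_def)
    with None e show thesis by (intro that(1)) simp_all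
  next
    case (Some M)
    obtain \<gamma> where \<gamma>: "M \<in> multipartitions 2"
      "?r [fst x, snd x] = \<gamma> # ?r M"
      by (rule e_op_Some[OF L Some], rule that)
    note M = multipartitions_2D[OF \<gamma>(1)]
    show thesis
    proof (rule that(2))
      show "tensor_e k l j x = Some (M ! 0, M ! 1)" by (simp add: e Some)
      show "(M ! 0, M ! 1) \<in> partitions \<times> partitions" by (rule M)
    qed (use \<gamma> M(1) in \<open>simp_all add: tensor_word_def remaining_eq_uncancelled\<close>)
  qed
qed

lemma tensor_crystal_iso_closed:
  "tensor_crystal_iso k l \<psi> \<Longrightarrow> x \<in> partitions \<times> partitions \<Longrightarrow> \<psi> x \<in> partitions \<times> partitions"
  unfolding tensor_crystal_iso_def by (blast dest: bij_betwE)

text \<open>The number of uncancelled \<open>A\<close> (resp. \<open>R\<close>) counts how often \<open>f\<close> (resp. \<open>e\<close>) can be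
  applied, hence is a crystal invariant.\<close>

lemma length_uncancelled_tensor_iso:
  assumes iso: "tensor_crystal_iso k l \<psi>" and x: "x \<in> partitions \<times> partitions"
  shows "length (uncancelled z (tensor_word l k j (\<psi> x))) = length (uncancelled z (tensor_word k l j x))"
  using x
proof (induction "length (uncancelled z (tensor_word k l j x))" arbitrary: x rule: less_induct)
  case less
  note \<psi>x = tensor_crystal_iso_closed[OF iso less.prems]
  have f: "tensor_f l k j (\<psi> x) = map_option \<psi> (tensor_f k l j x)"
    and e: "tensor_e l k j (\<psi> x) = map_option \<psi> (tensor_e k l j x)"
    using iso less.prems by (auto simp: tensor_crystal_iso_def)
  show ?case
  proof (cases z)
    case Addable
    show ?thesis
    \<comment> \<open>\<open>map_option \<psi>\<close> preserves and reflects \<open>None\<close>,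
      so the two mixed cases contradict \<open>f\<close>; when both values exist, both counts drop
      by one.\<close>
    proof (rule tensor_f_cases[OF less.prems, of k l j]; rule tensor_f_cases[OF \<psi>x, of l k j])
      fix y y' assume "tensor_f k l j x = Some y" "y \<in> partitions \<times> partitions"
        and y: "length (uncancelled Addable (tensor_word k l j x)) =
          Suc (length (uncancelled Addable (tensor_word k l j y)))"
        and y': "tensor_f l k j (\<psi> x) = Some y'"
          "length (uncancelled Addable (tensor_word l k j (\<psi> x))) =
          Suc (length (uncancelled Addable (tensor_word l k j y')))"
      moreover have "y' = \<psi> y" using calculation f by simp
      ultimately show ?thesis using less.hyps[of y] Addable by simp
    qed (use f Addable in simp_all)
  next
    case Removable
    show ?thesis
    proof (rule tensor_e_cases[OF less.prems, of k l j]; rule tensor_e_cases[OF \<psi>x, of l k j])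
      fix y y' assume "tensor_e k l j x = Some y" "y \<in> partitions \<times> partitions"
        and y: "length (uncancelled Removable (tensor_word k l j x)) =
          Suc (length (uncancelled Removable (tensor_word k l j y)))"
        and y': "tensor_e l k j (\<psi> x) = Some y'"
          "length (uncancelled Removable (tensor_word l k j (\<psi> x))) =
          Suc (length (uncancelled Removable (tensor_word l k j y')))"
      moreover have "y' = \<psi> y" using calculation e by simp
      ultimately show ?thesis using less.hyps[of y] Removable by simp
    qed (use e Removable in simp_all)
  qed
qed

lemma tensor_word:
  assumes "x \<in> partitions \<times> partitions"
  shows "sorted_wrt (\<lambda>x y. component (snd x) < component (snd y)) (tensor_word k l j x)"
    and "set (tensor_word k l j x) =
      {(Addable, \<gamma>) |\<gamma>. addable [fst x, snd x] \<gamma> \<and> content [k, l] \<gamma> = j} \<union>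
      {(Removable, \<gamma>) |\<gamma>. removable [fst x, snd x] \<gamma> \<and> content [k, l] \<gamma> = j}"
proof -
  have x: "fst x \<in> partitions" "snd x \<in> partitions" using assms by auto
  show "sorted_wrt (\<lambda>x y. component (snd x) < component (snd y)) (tensor_word k l j x)"
    unfolding tensor_word_def by (rule signature_word_tensor(1)[OF x])
  show "set (tensor_word k l j x) =
      {(Addable, \<gamma>) |\<gamma>. addable [fst x, snd x] \<gamma> \<and> content [k, l] \<gamma> = j} \<union>
      {(Removable, \<gamma>) |\<gamma>. removable [fst x, snd x] \<gamma> \<and> content [k, l] \<gamma> = j}"
    unfolding tensor_word_def by (rule signature_word_tensor(2)[OF x])
qed

lemma component_tensor_word:
  assumes "x \<in> partitions \<times> partitions" "y \<in> set (tensor_word k l j x)"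
  shows "component (snd y) < 2"
proof -
  obtain z a b c where y: "y = (z, a, b, c)" by (cases y)
  have "c < length [fst x, snd x]"
    using assms(2) addable_pos[of "[fst x, snd x]" a b c] nodes_pos[of a b c "[fst x, snd x]"]
    unfolding tensor_word(2)[OF assms(1)] y by (auto simp: removable_def)
  then show ?thesis by (simp add: y component_def)
qed

section \<open>The image of the empty pair\<close>

lemma ex_removable:
  assumes L: "L \<in> multipartitions l" and c: "c < l" and ne: "L ! c \<noteq> []"
  obtains a b where "removable L (a, b, c)"
proof -
  have len: "length L = l" using L by (simp add: multipartitions_def)
  have "L ! c \<in> partitions" using L c by (auto simp: multipartitions_def)
  then have "0 < L ! c ! (length (L ! c) - 1)"
    using ne by (metis (no_types, lifting) CollectD diff_less gr0I length_greater_0_conv nth_mem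
        partitions_def zero_less_one)
  \<comment> \<open>The witness is the end of the last row, which is nonempty because partitions
    have no zero parts.\<close>
  then have "removable L (length (L ! c), L ! c ! (length (L ! c) - 1), c)"
    using ne c len by (auto simp: removable_iff[OF L] nodes_def Suc_le_eq)
  then show thesis by (rule that)
qed

text \<open>The empty pair has no R at any content, so its image has no surviving R. That alone
  admits vertices whose first factor has an R cancelled by the second factor; they are excluded by
  counting surviving A's at content \<open>k\<close>.\<close>

lemma tensor_crystal_iso_empty:
  assumes iso: "tensor_crystal_iso k l \<psi>"
  shows "\<psi> ([], []) = ([], [])"
proof -
  define E :: "nat list \<times> nat list" where "E = ([], [])"
  have E: "E \<in> partitions \<times> partitions" by (simp add: partitions_def E_def)
  note \<psi>E = tensor_crystal_iso_closed[OF iso E]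
  obtain \<mu> \<nu> where \<mu>\<nu>: "\<psi> E = (\<mu>, \<nu>)" by (cases "\<psi> E")
  have part: "\<mu> \<in> partitions" "\<nu> \<in> partitions" using \<psi>E \<mu>\<nu> by auto
  have L: "[\<mu>, \<nu>] \<in> multipartitions 2" using part by (simp add: multipartitions_def)
  have E2: "[[], []] \<in> multipartitions 2" by (simp add: multipartitions_def partitions_def)
  have nodes_E: "nodes [[], []] = {}" by (auto simp: nodes_def nth_Cons split: nat.splits)
  have letters: "fst y = Addable" if "y \<in> set (tensor_word k l j E)" for y j
    using that unfolding tensor_word(2)[OF E] by (auto simp: E_def removable_def nodes_E)
  have no_R: "uncancelled Removable (tensor_word l k j (\<psi> E)) = []" for j
  proof -
    have "uncancelled Removable (tensor_word k l j E) = []"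
      using letters set_uncancelled[of _ Removable "tensor_word k l j E"]
      by (metis fst_conv letter.distinct(1) list.set_intros(1) neq_Nil_conv)
    then show ?thesis using length_uncancelled_tensor_iso[OF iso E, of Removable j] by simp
  qed
  note word = tensor_word[OF \<psi>E] and comp = component_tensor_word[OF \<psi>E]
  \<comment> \<open>An R of the second factor is the last letter of its word, and nothing behind it
    could cancel it.\<close>
  have "\<nu> = []"
  proof (rule ccontr)
    assume "\<nu> \<noteq> []"
    then obtain a b where rem: "removable [\<mu>, \<nu>] (a, b, 1)"
      using ex_removable[OF L, of 1] by auto
    define j where "j = content [l, k] (a, b, 1)"
    have "(Removable, (a, b, 1)) \<in> set (tensor_word l k j (\<psi> E))"
      using rem \<mu>\<nu> unfolding word(2) by (simp add: j_def)
    then obtain u v where w: "tensor_word l k j (\<psi> E) = u @ (Removable, (a, b, 1)) # v"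
      by (meson split_list)
    have "y \<notin> set v" for y
      using word(1)[of l k j] comp[of y l k j] unfolding w
      by (fastforce simp: sorted_wrt_append component_def)
    then have "v = []" by (cases v) auto
    then show False using no_R[of j] w by (simp add: uncancelled_append)
  qed
  \<comment> \<open>An R of the first factor must be cancelled by an A of the second. The only
    addable node of the empty \<nu> is its corner, of content \<open>k\<close>, so the R has content
    \<open>k\<close> as well and the whole word is RA.\<close>
  moreover have "\<mu> = []"
  proof (rule ccontr)
    assume "\<mu> \<noteq> []"
    then obtain a b where rem: "removable [\<mu>, \<nu>] (a, b, 0)"
      using ex_removable[OF L, of 0] by auto
    define j where "j = content [l, k] (a, b, 0)"
    let ?w = "tensor_word l k j (\<psi> E)"
    have "(Removable, (a, b, 0)) \<in> set ?w"
      using rem \<mu>\<nu> unfolding word(2) by (simp add: j_def)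
    then obtain u v where w: "?w = u @ (Removable, (a, b, 0)) # v"
      by (meson split_list)
    have "component (snd y) < component (a, b, 0)" if "y \<in> set u" for y
      using that word(1)[of l k j] unfolding w by (auto simp: sorted_wrt_append)
    then have "y \<notin> set u" for y by (cases y) (auto simp: component_def)
    then have u: "u = []" by (cases u) auto
    have cv: "component (snd y) = 1" if "y \<in> set v" for y
      using that word(1)[of l k j] comp[of y l k j] unfolding w
      by (auto simp: sorted_wrt_append component_def split: prod.splits)
    have "v \<noteq> []" using no_R[of j] w u by auto
    then obtain y v' where v: "v = y # v'" by (cases v) auto
    have "z \<notin> set v'" for z
      using word(1)[of l k j] cv[of y] cv[of z] unfolding w v by (auto simp: sorted_wrt_append)
    then have v': "v' = []" by (cases v') auto
    obtain z a' b' c' where y: "y = (z, a', b', c')" by (cases y)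
    have c': "c' = 1" using cv[of y] v y by (simp add: component_def)
    have z: "z = Addable" using no_R[of j] w u v v' y by (cases z) auto
    have "y \<in> set ?w" using w v by simp
    then have add: "addable [\<mu>, \<nu>] (a', b', 1)" "content [l, k] (a', b', 1) = j"
      using \<mu>\<nu> unfolding word(2) y c' z by auto
    have "a' = 1" "b' = 1"
      using add(1) \<open>\<nu> = []\<close> unfolding addable_iff[OF L] by (auto simp: nodes_def)
    then have j: "j = k" using add(2) by (simp add: content_def)
    have "uncancelled Addable ?w = []" using w u v v' y z by simp
    then have none: "uncancelled Addable (tensor_word k l k E) = []"
      using length_uncancelled_tensor_iso[OF iso E, of Addable k] j by simp
    \<comment> \<open>The contradiction: RA keeps no A, whereas the word of the empty pair at
      content \<open>k\<close> has only A's, among them the corner of the first factor.\<close>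
    have "(Addable, (1, 1, 0)) \<in> set (tensor_word k l k E)"
      unfolding tensor_word(2)[OF E]
      by (auto simp: E_def addable_iff[OF E2] nodes_E content_def)
    moreover have "length (uncancelled Addable w) = length w" if "\<forall>y \<in> set w. fst y = Addable" for w
      using that by (induction w rule: letter_word_induct) auto
    ultimately show False using none letters[of _ k] by (metis length_0_conv list.size(3) length_pos_if_in_set less_irrefl)
  qed
  ultimately show ?thesis using \<mu>\<nu> by (simp add: E_def)
qed


section \<open>The exchange of two adjacent components\<close>

lemma nth_mem_partitions: "L \<in> multipartitions l \<Longrightarrow> c < l \<Longrightarrow> L ! c \<in> partitions"
  by (auto simp: multipartitions_def)

lemma addable_removable_cong:
  assumes L: "L \<in> multipartitions l" and M: "M \<in> multipartitions m" and c: "c < l" "d < m"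
    and eq: "L ! c = M ! d"
  shows "addable L (a, b, c) \<longleftrightarrow> addable M (a, b, d)"
    and "removable L (a, b, c) \<longleftrightarrow> removable M (a, b, d)"
proof -
  have "(a, b, c) \<in> nodes L \<longleftrightarrow> (a, b, d) \<in> nodes M" for a b
    using L M c eq by (auto simp: nodes_def multipartitions_def)
  then show "addable L (a, b, c) \<longleftrightarrow> addable M (a, b, d)"
    and "removable L (a, b, c) \<longleftrightarrow> removable M (a, b, d)"
    using c by (simp_all add: addable_iff[OF L] addable_iff[OF M] removable_iff[OF L] removable_iff[OF M])
qed

lemma nth_eq_iff_nodes:
  assumes L: "L \<in> multipartitions l" and M: "M \<in> multipartitions m" and c: "c < l" "d < m"
  shows "L ! c = M ! d \<longleftrightarrow> (\<forall>a b. (a, b, c) \<in> nodes L \<longleftrightarrow> (a, b, d) \<in> nodes M)"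
proof
  assume "L ! c = M ! d"
  then show "\<forall>a b. (a, b, c) \<in> nodes L \<longleftrightarrow> (a, b, d) \<in> nodes M"
    using L M c by (auto simp: nodes_def multipartitions_def)
next
  assume eq: "\<forall>a b. (a, b, c) \<in> nodes L \<longleftrightarrow> (a, b, d) \<in> nodes M"
  \<comment> \<open>Passing to multipartitions with one component reduces equality of partitions to
    injectivity of \<open>nodes\<close>.\<close>
  have "nodes [L ! c] = nodes [M ! d]"
  proof (rule set_eqI)
    fix \<gamma> :: node obtain a b z where \<gamma>: "\<gamma> = (a, b, z)" by (cases \<gamma>)
    show "\<gamma> \<in> nodes [L ! c] \<longleftrightarrow> \<gamma> \<in> nodes [M ! d]"
      using eq[rule_format, of a b] L M c unfolding \<gamma> by (cases z) (simp_all add: nodes_def multipartitions_def)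
  qed
  then have "[L ! c] = [M ! d]"
    using nth_mem_partitions[OF L c(1)] nth_mem_partitions[OF M c(2)]
    by (intro inj_onD[OF inj_on_nodes[of 1]]) (auto simp: multipartitions_def)
  then show "L ! c = M ! d" by simp
qed

lemma add_node_eqI:
  assumes "addable L \<gamma>" "M \<in> multipartitions (length L)" "nodes M = insert \<gamma> (nodes L)"
  shows "add_node L \<gamma> = M"
  using add_node[OF assms(1)] assms(2,3) by (intro inj_onD[OF inj_on_nodes]) auto

section \<open>Blocks of a signature word\<close>

definition block :: "int list \<Rightarrow> int \<Rightarrow> nat set \<Rightarrow> nat list list \<Rightarrow> (letter \<times> node) list" where
  "block s c C = signature_word (\<lambda>\<gamma> \<delta>. node_less s \<delta> \<gamma>) (\<lambda>\<gamma>. content s \<gamma> = c \<and> component \<gamma> \<in> C)"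

lemma node_order_block:
  "node_order s (\<lambda>\<gamma> \<delta>. node_less s \<delta> \<gamma>) (\<lambda>\<gamma>. content s \<gamma> = c \<and> component \<gamma> \<in> C)"
  by (rule node_order_affine) auto

lemma set_block:
  assumes "L \<in> multipartitions l"
  shows "set (block s c C L) =
    {(Addable, \<gamma>) |\<gamma>. addable L \<gamma> \<and> content s \<gamma> = c \<and> component \<gamma> \<in> C} \<union>
    {(Removable, \<gamma>) |\<gamma>. removable L \<gamma> \<and> content s \<gamma> = c \<and> component \<gamma> \<in> C}"
  unfolding block_def by (rule node_order.set_signature_word[OF node_order_block assms])

lemma sorted_block:
  assumes "L \<in> multipartitions l"
  shows "sorted_wrt (\<lambda>x y. node_less s (snd y) (snd x)) (block s c C L)"
  unfolding block_def by (rule node_order.sorted_signature_word[OF node_order_block assms])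

text \<open>Within one content \<open>node_less\<close> compares component indices only, so a block
  can be checked against a word that was sorted for another multicharge.\<close>

lemma block_unique:
  assumes L: "L \<in> multipartitions l"
    and sorted: "sorted_wrt (\<lambda>x y. component (snd y) < component (snd x)) w"
    and set: "set w = set (block s c C L)"
  shows "block s c C L = w"
proof (rule node_order.word_unique[OF node_order_block])
  have "content s (snd x) = c" if "x \<in> set w" for x
    using that unfolding set set_block[OF L] by auto
  then show "sorted_wrt (\<lambda>x y. node_less s (snd y) (snd x)) w"
    by (intro sorted_wrt_mono_rel[OF _ sorted]) (simp add: node_less_def)
qed (use set sorted_block[OF L] in auto)

lemma sorted_block_component:
  assumes L: "L \<in> multipartitions l"
  shows "sorted_wrt (\<lambda>x y. component (snd y) < component (snd x)) (block s c C L)"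
proof (rule sorted_wrt_mono_rel[OF _ sorted_block[OF L]])
  fix x y assume "x \<in> set (block s c C L)" "y \<in> set (block s c C L)" "node_less s (snd y) (snd x)"
  then show "component (snd y) < component (snd x)"
    unfolding set_block[OF L] by (auto simp: node_less_def)
qed

text \<open>The reading order is lexicographic in content and component, and
  \<open>List.product\<close> enumerates pairs lexicographically. \<open>cs\<close> may contain
  contents that do not occur in \<open>L\<close>; their blocks are empty, which lets one list serve
  two multipartitions.\<close>

lemma signature_word_eq_concat_blocks:
  assumes L: "L \<in> multipartitions l" and "node_order s (\<lambda>\<gamma> \<delta>. node_less s \<delta> \<gamma>) (\<lambda>\<gamma>. Q (content s \<gamma>))"
    and cs: "sorted_wrt (>) cs" "\<And>c. c \<in> set cs \<Longrightarrow> Q c"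
      "\<And>\<gamma>. addable L \<gamma> \<or> removable L \<gamma> \<Longrightarrow> Q (content s \<gamma>) \<Longrightarrow> content s \<gamma> \<in> set cs"
    and Cs: "sorted_wrt (\<lambda>C D. \<forall>x \<in> C. \<forall>y \<in> D. y < x) Cs" "\<Union>(set Cs) = UNIV"
  shows "signature_word (\<lambda>\<gamma> \<delta>. node_less s \<delta> \<gamma>) (\<lambda>\<gamma>. Q (content s \<gamma>)) L =
    concat (map (\<lambda>(c, C). block s c C L) (List.product cs Cs))"
proof -
  interpret node_order s "\<lambda>\<gamma> \<delta>. node_less s \<delta> \<gamma>" "\<lambda>\<gamma>. Q (content s \<gamma>)" by fact
  let ?S = "\<lambda>(c, C) (d, D). d < c \<or> c = d \<and> (\<forall>x \<in> C. \<forall>y \<in> D. y < x)"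
  let ?w = "concat (map (\<lambda>(c, C). block s c C L) (List.product cs Cs))"
  have "sorted_wrt ?S (concat (map (\<lambda>c. map (Pair c) Cs) cs))"
  proof (rule sorted_wrt_concat_map[OF cs(1)])
    show "sorted_wrt ?S (map (Pair c) Cs)" for c
      unfolding sorted_wrt_map by (rule sorted_wrt_mono_rel[OF _ Cs(1)]) simp
  qed auto
  moreover have "concat (map (\<lambda>c. map (Pair c) Cs) cs) = List.product cs Cs"
    by (induction cs) auto
  ultimately have "sorted_wrt ?S (List.product cs Cs)" by simp
  then have "sorted_wrt (\<lambda>x y. node_less s (snd y) (snd x)) ?w"
  proof (rule sorted_wrt_concat_map)
    show "sorted_wrt (\<lambda>x y. node_less s (snd y) (snd x)) (case p of (c, C) \<Rightarrow> block s c C L)" for p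
      using sorted_block[OF L] by (auto split: prod.split)
    show "node_less s (snd y) (snd x)"
      if "?S p q" "x \<in> set (case p of (c, C) \<Rightarrow> block s c C L)" "y \<in> set (case q of (c, C) \<Rightarrow> block s c C L)"
      for p q x y
      using that unfolding node_less_def by (auto simp: set_block[OF L] split: prod.splits)
  qed
  moreover have "set ?w = set (signature_word (\<lambda>\<gamma> \<delta>. node_less s \<delta> \<gamma>) (\<lambda>\<gamma>. Q (content s \<gamma>)) L)"
  proof (rule set_eqI)
    fix x :: "letter \<times> node"
    obtain C where C: "C \<in> set Cs" "component (snd x) \<in> C" using Cs(2) by blast
    have "x \<in> set ?w \<longleftrightarrow> (\<exists>c \<in> set cs. \<exists>C \<in> set Cs. x \<in> set (block s c C L))" by auto
    also have "\<dots> \<longleftrightarrow> x \<in> set (signature_word (\<lambda>\<gamma> \<delta>. node_less s \<delta> \<gamma>) (\<lambda>\<gamma>. Q (content s \<gamma>)) L)"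
      unfolding set_block[OF L] set_signature_word[OF L] using cs(2,3) C by (cases x) auto
    finally show "x \<in> set ?w \<longleftrightarrow>
      x \<in> set (signature_word (\<lambda>\<gamma> \<delta>. node_less s \<delta> \<gamma>) (\<lambda>\<gamma>. Q (content s \<gamma>)) L)" .
  qed
  ultimately show ?thesis using sorted_signature_word[OF L] by (intro word_unique) auto
qed

text \<open>At equal content the larger component is read first, so the factors 0 and 1 of the tensor product
  are the components \<open>i\<close> and \<open>i - 1\<close>.\<close>

definition relabel :: "nat \<Rightarrow> node \<Rightarrow> node" where
  "relabel i = (\<lambda>(a, b, c). (a, b, i - c))"

lemma block_eq_map_tensor_word:
  assumes L: "L \<in> multipartitions l" and i: "0 < i" "i < l"
  shows "block s c {i - 1, i} L =
    map (map_prod id (relabel i)) (tensor_word (s ! i) (s ! (i - 1)) c (L ! i, L ! (i - 1)))"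
proof (rule block_unique[OF L])
  let ?x = "(L ! i, L ! (i - 1))" and ?k = "s ! i" and ?l = "s ! (i - 1)"
  have part: "L ! i \<in> partitions" "L ! (i - 1) \<in> partitions"
    using i by (auto intro: nth_mem_partitions[OF L])
  then have x: "?x \<in> partitions \<times> partitions" by simp
  have K: "[L ! i, L ! (i - 1)] \<in> multipartitions 2" using part by (simp add: multipartitions_def)
  have le: "component (snd y) \<le> 1" if "y \<in> set (tensor_word ?k ?l c ?x)" for y
    using component_tensor_word[OF x that] by simp
  show "sorted_wrt (\<lambda>x y. component (snd y) < component (snd x))
     (map (map_prod id (relabel i)) (tensor_word ?k ?l c ?x))"
    unfolding sorted_wrt_map
  proof (rule sorted_wrt_mono_rel[OF _ tensor_word(1)[OF x]])
    fix y z assume "y \<in> set (tensor_word ?k ?l c ?x)" "z \<in> set (tensor_word ?k ?l c ?x)"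
      and "component (snd y) < component (snd z)"
    then show "component (snd (map_prod id (relabel i) z)) < component (snd (map_prod id (relabel i) y))"
      using le[of z] i by (auto simp: relabel_def component_def split: prod.splits)
  qed
  \<comment> \<open>The guard \<open>d \<le> 1\<close> matters because subtraction truncates: for i
    = 1 and d >= 2 the index \<open>i - d\<close> would be 0 = i - 1.\<close>
  have transfer: "(z, a, b, d) \<in> set (tensor_word ?k ?l c ?x) \<longleftrightarrow>
      d \<le> 1 \<and> (z, a, b, i - d) \<in> set (block s c {i - 1, i} L)" for z a b d
  proof (cases "d \<le> 1")
    case True
    then have idx: "[L ! i, L ! (i - 1)] ! d = L ! (i - d)" "[?k, ?l] ! d = s ! (i - d)" "d < 2" "i - d < l"
      "i - d \<in> {i - 1, i}"
      using i by (auto simp: le_Suc_eq)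
    note cong = addable_removable_cong[OF K L idx(3,4,1), of a b]
    show ?thesis
      unfolding tensor_word(2)[OF x] set_block[OF L] Un_iff mem_Collect_eq
      using True idx cong by (cases z) (simp_all add: content_def component_def)
  next
    case False
    then show ?thesis using le[of "(z, a, b, d)"] by (auto simp: component_def)
  qed
  show "set (map (map_prod id (relabel i)) (tensor_word ?k ?l c ?x)) = set (block s c {i - 1, i} L)"
  proof (intro set_eqI iffI)
    fix y assume "y \<in> set (map (map_prod id (relabel i)) (tensor_word ?k ?l c ?x))"
    then obtain z a b d where "(z, a, b, d) \<in> set (tensor_word ?k ?l c ?x)" "y = (z, a, b, i - d)"
      by (auto simp: relabel_def)
    then show "y \<in> set (block s c {i - 1, i} L)" using transfer by simp
  next
    fix y assume y: "y \<in> set (block s c {i - 1, i} L)"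
    obtain z a b d where zd: "y = (z, a, b, d)" by (cases y)
    have "d = i \<or> d = i - 1" using y unfolding zd set_block[OF L] by (auto simp: component_def)
    then have d: "i - (i - d) = d" "i - d \<le> 1" using i by auto
    then have "(z, a, b, i - d) \<in> set (tensor_word ?k ?l c ?x)" using y transfer zd by simp
    moreover have "y = map_prod id (relabel i) (z, a, b, i - d)" using zd d by (simp add: relabel_def)
    ultimately show "y \<in> set (map (map_prod id (relabel i)) (tensor_word ?k ?l c ?x))"
      unfolding set_map by (rule rev_image_eqI)
  qed
qed

text \<open>The first factor of the image goes to component i, which is read first and which carries
  the charge \<open>s ! (i - 1)\<close> after the exchange.\<close>

definition exchange ::
    "(nat list \<times> nat list \<Rightarrow> nat list \<times> nat list) \<Rightarrow> nat \<Rightarrow> nat list list \<Rightarrow> nat list list" where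
  "exchange \<psi> i L = L[i - 1 := snd (\<psi> (L ! i, L ! (i - 1))), i := fst (\<psi> (L ! i, L ! (i - 1)))]"

lemma update_multipartition:
  assumes "L \<in> multipartitions l" "p \<in> partitions" "q \<in> partitions"
  shows "L[i - 1 := q, i := p] \<in> multipartitions l"
proof -
  have "set (L[i - 1 := q, i := p]) \<subseteq> insert p (insert q (set L))"
    using set_update_subset_insert[of "L[i - 1 := q]" i p] set_update_subset_insert[of L "i - 1" q]
    by blast
  then show ?thesis using assms by (auto simp: multipartitions_def)
qed

lemma add_node_relabel:
  assumes L: "L \<in> multipartitions l" and i: "0 < i" "i < l"
    and add: "addable [L ! i, L ! (i - 1)] \<delta>" and eq: "[p, q] = add_node [L ! i, L ! (i - 1)] \<delta>"
  shows "add_node L (relabel i \<delta>) = L[i - 1 := q, i := p]"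
proof (rule add_node_eqI)
  have len: "length L = l" using L by (simp add: multipartitions_def)
  have K: "[L ! i, L ! (i - 1)] \<in> multipartitions 2"
    using i nth_mem_partitions[OF L, of i] nth_mem_partitions[OF L, of "i - 1"]
    by (simp add: multipartitions_def)
  have pq: "[p, q] \<in> multipartitions 2" "nodes [p, q] = insert \<delta> (nodes [L ! i, L ! (i - 1)])"
    using add_node[OF add] K unfolding eq by (auto simp: multipartitions_def)
  obtain a b d where \<delta>: "\<delta> = (a, b, d)" by (cases \<delta>)
  have d: "d = 0 \<or> d = 1" using addable_pos[OF add[unfolded \<delta>]] by auto
  then have idx: "d < 2" "i - d < l" "[L ! i, L ! (i - 1)] ! d = L ! (i - d)" using i by auto
  show "addable L (relabel i \<delta>)"
    using add addable_removable_cong(1)[OF K L idx, of a b] by (simp add: \<delta> relabel_def)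
  show "L[i - 1 := q, i := p] \<in> multipartitions (length L)"
    using update_multipartition[OF L, of p q i] pq(1) len by (simp add: multipartitions_def)
  show "nodes (L[i - 1 := q, i := p]) = insert (relabel i \<delta>) (nodes L)"
  proof (rule set_eqI)
    fix \<gamma> :: node obtain x y z where \<gamma>: "\<gamma> = (x, y, z)" by (cases \<gamma>)
    have zero: "(x, y, 0) \<in> nodes [p, q] \<longleftrightarrow> (x, y, 0) = \<delta> \<or> (x, y, 0) \<in> nodes [L ! i, L ! (i - 1)]"
      and one: "(x, y, 1) \<in> nodes [p, q] \<longleftrightarrow> (x, y, 1) = \<delta> \<or> (x, y, 1) \<in> nodes [L ! i, L ! (i - 1)]"
      using pq(2) by auto
    consider "z = i" | "z = i - 1" "z \<noteq> i" | "z \<noteq> i" "z \<noteq> i - 1" by blast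
    then show "\<gamma> \<in> nodes (L[i - 1 := q, i := p]) \<longleftrightarrow> \<gamma> \<in> insert (relabel i \<delta>) (nodes L)"
    proof cases
      case 1
      then show ?thesis using zero i len d unfolding \<gamma> \<delta> by (auto simp: nodes_def relabel_def)
    next
      case 2
      then show ?thesis using one i len d unfolding \<gamma> \<delta> by (auto simp: nodes_def relabel_def)
    next
      case 3
      then show ?thesis using i len d unfolding \<gamma> \<delta> by (auto simp: nodes_def relabel_def nth_list_update)
    qed
  qed
qed

lemma add_node_nth:
  assumes L: "L \<in> multipartitions l" and add: "addable L \<gamma>" and c: "c < l" "component \<gamma> \<noteq> c"
  shows "add_node L \<gamma> ! c = L ! c"
proof -
  have len: "length L = l" using L by (simp add: multipartitions_def)
  note M = add_node[OF add, unfolded len]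
  show ?thesis unfolding nth_eq_iff_nodes[OF M(1) L c(1) c(1)] M(2) using c(2) by (auto simp: component_def)
qed

lemma add_node_update:
  assumes L: "L \<in> multipartitions l" and i: "0 < i" "i < l"
    and add: "addable L \<gamma>" and c: "component \<gamma> \<notin> {i - 1, i}"
    and p: "p \<in> partitions" and q: "q \<in> partitions"
  shows "add_node (L[i - 1 := q, i := p]) \<gamma> = (add_node L \<gamma>)[i - 1 := q, i := p]"
proof (rule add_node_eqI)
  have len: "length L = l" using L by (simp add: multipartitions_def)
  note N = add_node[OF add, unfolded len]
  have lenN: "length (add_node L \<gamma>) = l" using N(1) by (simp add: multipartitions_def)
  obtain a b d where \<gamma>: "\<gamma> = (a, b, d)" by (cases \<gamma>)
  have d: "d \<noteq> i" "d \<noteq> i - 1" "d < l" using c addable_pos[OF add[unfolded \<gamma>]] len by (auto simp: \<gamma> component_def)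
  note M = update_multipartition[OF L p q, of i]
  have eq: "L ! d = L[i - 1 := q, i := p] ! d" using d by simp
  show "addable (L[i - 1 := q, i := p]) \<gamma>"
    using add addable_removable_cong(1)[OF L M d(3) d(3) eq, of a b] by (simp add: \<gamma>)
  show "(add_node L \<gamma>)[i - 1 := q, i := p] \<in> multipartitions (length (L[i - 1 := q, i := p]))"
    using update_multipartition[OF N(1) p q, of i] len by simp
  show "nodes ((add_node L \<gamma>)[i - 1 := q, i := p]) = insert \<gamma> (nodes (L[i - 1 := q, i := p]))"
  proof (rule set_eqI)
    fix \<delta> :: node obtain x y z where \<delta>: "\<delta> = (x, y, z)" by (cases \<delta>)
    have N': "(x, y, z) \<in> nodes (add_node L \<gamma>) \<longleftrightarrow> (x, y, z) = (a, b, d) \<or> (x, y, z) \<in> nodes L"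
      unfolding N(2) by (simp add: \<gamma>)
    show "\<delta> \<in> nodes ((add_node L \<gamma>)[i - 1 := q, i := p]) \<longleftrightarrow> \<delta> \<in> insert \<gamma> (nodes (L[i - 1 := q, i := p]))"
    proof (cases "z = i \<or> z = i - 1")
      case True
      then show ?thesis using i d len lenN unfolding \<delta> \<gamma> by (auto simp: nodes_def nth_list_update)
    next
      case False
      then have "(x, y, z) \<in> nodes (K[i - 1 := q, i := p]) \<longleftrightarrow> (x, y, z) \<in> nodes K" for K
        by (simp add: nodes_def)
      then show ?thesis using N' unfolding \<delta> \<gamma> by simp
    qed
  qed
qed

lemma exchange_multipartition:
  assumes L: "L \<in> multipartitions l" and i: "0 < i" "i < l" and iso: "tensor_crystal_iso j k \<psi>"
  shows "exchange \<psi> i L \<in> multipartitions l"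
proof -
  have "\<psi> (L ! i, L ! (i - 1)) \<in> partitions \<times> partitions"
    using i by (intro tensor_crystal_iso_closed[OF iso]) (auto intro!: nth_mem_partitions[OF L])
  then show ?thesis
    unfolding exchange_def by (intro update_multipartition[OF L]) auto
qed

section \<open>Compatibility of the exchange map with the operators\<close>

locale adjacent_exchange =
  fixes s :: "int list" and i :: nat and \<psi> :: "nat list \<times> nat list \<Rightarrow> nat list \<times> nat list"
  assumes i: "0 < i" "i < length s" and iso: "tensor_crystal_iso (s ! i) (s ! (i - 1)) \<psi>"
begin

abbreviation "s' \<equiv> s[i - 1 := s ! i, i := s ! (i - 1)]"
abbreviation "\<Phi> \<equiv> exchange \<psi> i"
abbreviation "pair L \<equiv> (L ! i, L ! (i - 1))"

lemma pair_mem: "L \<in> multipartitions (length s) \<Longrightarrow> pair L \<in> partitions \<times> partitions"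
  using i by (auto intro!: nth_mem_partitions)

lemma \<Phi>_mem: "L \<in> multipartitions (length s) \<Longrightarrow> \<Phi> L \<in> multipartitions (length s)"
  using i iso by (intro exchange_multipartition)

lemma s'_nth: "s' ! i = s ! (i - 1)" "s' ! (i - 1) = s ! i" "d \<noteq> i \<Longrightarrow> d \<noteq> i - 1 \<Longrightarrow> s' ! d = s ! d"
  using i by simp_all

lemma \<Phi>_nth:
  assumes "L \<in> multipartitions (length s)"
  shows "pair (\<Phi> L) = \<psi> (pair L)" "d \<noteq> i \<Longrightarrow> d \<noteq> i - 1 \<Longrightarrow> \<Phi> L ! d = L ! d"
  using i assms by (simp_all add: exchange_def multipartitions_def)

lemma block_exchange_outside:
  assumes L: "L \<in> multipartitions (length s)" and C: "i \<notin> C" "i - 1 \<notin> C"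
  shows "block s' c C (\<Phi> L) = block s c C L"
proof (rule block_unique[OF \<Phi>_mem[OF L] sorted_block_component[OF L]])
  have len: "length L = length s" "length (\<Phi> L) = length s"
    using L \<Phi>_mem[OF L] by (auto simp: multipartitions_def)
  have cong: "addable L (a, b, d) \<longleftrightarrow> addable (\<Phi> L) (a, b, d)"
    "removable L (a, b, d) \<longleftrightarrow> removable (\<Phi> L) (a, b, d)"
    "content s (a, b, d) = content s' (a, b, d)" if "d \<in> C" for a b d
  proof -
    have d: "d \<noteq> i" "d \<noteq> i - 1" using that C by auto
    show "content s (a, b, d) = content s' (a, b, d)" using s'_nth(3)[OF d] by (simp add: content_def)
    have "addable L (a, b, d) = addable (\<Phi> L) (a, b, d) \<and> removable L (a, b, d) = removable (\<Phi> L) (a, b, d)"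
    proof (cases "d < length s")
      case True
      then show ?thesis
        using addable_removable_cong[OF L \<Phi>_mem[OF L] True True \<Phi>_nth(2)[OF L d, symmetric], of a b] by blast
    next
      \<comment> \<open>\<open>C\<close> may be an infinite interval; component indices beyond the
        length carry no letter on either side.\<close>
      case False
      then show ?thesis
        using addable_pos[of L a b d] addable_pos[of "\<Phi> L" a b d] nodes_pos[of a b d L] nodes_pos[of a b d "\<Phi> L"] len
        by (auto simp: removable_def)
    qed
    then show "addable L (a, b, d) \<longleftrightarrow> addable (\<Phi> L) (a, b, d)"
      "removable L (a, b, d) \<longleftrightarrow> removable (\<Phi> L) (a, b, d)" by blast+
  qed
  show "set (block s c C L) = set (block s' c C (\<Phi> L))"
  proof (rule set_eqI)
    fix x :: "letter \<times> node" obtain z a b d where x: "x = (z, a, b, d)" by (cases x)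
    show "x \<in> set (block s c C L) \<longleftrightarrow> x \<in> set (block s' c C (\<Phi> L))"
      unfolding x set_block[OF L] set_block[OF \<Phi>_mem[OF L]]
      using cong[of d a b] by (cases "d \<in> C"; cases z) (simp_all add: component_def)
  qed
qed

lemma block_inside:
  assumes L: "L \<in> multipartitions (length s)"
  shows "block s c {i - 1, i} L =
      map (map_prod id (relabel i)) (tensor_word (s ! i) (s ! (i - 1)) c (pair L))"
    and "block s' c {i - 1, i} (\<Phi> L) =
      map (map_prod id (relabel i)) (tensor_word (s ! (i - 1)) (s ! i) c (\<psi> (pair L)))"
  using block_eq_map_tensor_word[OF L i, of s c] block_eq_map_tensor_word[OF \<Phi>_mem[OF L] i, of s' c]
  unfolding s'_nth(1,2) \<Phi>_nth(1)[OF L] .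

lemma length_block_exchange:
  assumes L: "L \<in> multipartitions (length s)" and C: "C = {i - 1, i} \<or> i \<notin> C \<and> i - 1 \<notin> C"
  shows "length (uncancelled z (block s' c C (\<Phi> L))) = length (uncancelled z (block s c C L))"
  using C
proof
  assume C: "C = {i - 1, i}"
  show ?thesis
    unfolding C block_inside[OF L] uncancelled_map length_map
    by (rule length_uncancelled_tensor_iso[OF iso pair_mem[OF L]])
next
  assume "i \<notin> C \<and> i - 1 \<notin> C"
  then have "block s' c C (\<Phi> L) = block s c C L" by (blast intro: block_exchange_outside[OF L])
  then show ?thesis by (simp only:)
qed

lemma add_last_block_exchange:
  assumes L: "L \<in> multipartitions (length s)" and C: "C = {i - 1, i} \<or> i \<notin> C \<and> i - 1 \<notin> C"
    and ne: "uncancelled Addable (block s c C L) \<noteq> []"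
  shows "\<Phi> (add_node L (last (uncancelled Addable (block s c C L)))) =
    add_node (\<Phi> L) (last (uncancelled Addable (block s' c C (\<Phi> L))))"
  using C
proof
  assume C: "i \<notin> C \<and> i - 1 \<notin> C"
  define \<gamma> where "\<gamma> = last (uncancelled Addable (block s c C L))"
  have "(Addable, \<gamma>) \<in> set (block s c C L)"
    unfolding \<gamma>_def using ne by (intro set_uncancelled last_in_set)
  then have add: "addable L \<gamma>" and \<gamma>: "component \<gamma> \<noteq> i" "component \<gamma> \<noteq> i - 1"
    using C unfolding set_block[OF L] by auto
  \<comment> \<open>\<gamma> lies outside the exchanged components, so \<psi> is evaluated at the
    same pair before and after the addition.\<close>
  have "pair (add_node L \<gamma>) = pair L"
    using add_node_nth[OF L add i(2) \<gamma>(1)] add_node_nth[OF L add _ \<gamma>(2)] i by simp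
  then have "\<Phi> (add_node L \<gamma>) = add_node (\<Phi> L) \<gamma>"
    using \<gamma> tensor_crystal_iso_closed[OF iso pair_mem[OF L]] unfolding exchange_def
    by (subst add_node_update[OF L i add]) auto
  moreover have "block s' c C (\<Phi> L) = block s c C L" using C by (blast intro: block_exchange_outside[OF L])
  ultimately show ?thesis by (simp only: \<gamma>_def)
next
  assume C: "C = {i - 1, i}"
  let ?k = "s ! i" and ?l = "s ! (i - 1)"
  define \<delta> where "\<delta> = last (uncancelled Addable (tensor_word ?k ?l c (pair L)))"
  define \<delta>' where "\<delta>' = last (uncancelled Addable (tensor_word ?l ?k c (\<psi> (pair L))))"
  note x = pair_mem[OF L]
  note \<psi>x = tensor_crystal_iso_closed[OF iso x]
  have len: "length L = length s" using L by (simp add: multipartitions_def)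
  have ne': "uncancelled Addable (tensor_word ?k ?l c (pair L)) \<noteq> []"
    using ne unfolding C block_inside[OF L] uncancelled_map by simp
  then have ne'': "uncancelled Addable (tensor_word ?l ?k c (\<psi> (pair L))) \<noteq> []"
    using length_uncancelled_tensor_iso[OF iso x, of Addable c] by (metis length_0_conv)
  obtain y where y: "tensor_f ?k ?l c (pair L) = Some y"
      "[fst y, snd y] = add_node [fst (pair L), snd (pair L)] \<delta>"
    unfolding \<delta>_def by (rule tensor_f_cases[OF x, of ?k ?l c]) (use ne' that in auto)
  obtain y' where y': "tensor_f ?l ?k c (\<psi> (pair L)) = Some y'"
      "[fst y', snd y'] = add_node [fst (\<psi> (pair L)), snd (\<psi> (pair L))] \<delta>'"
    unfolding \<delta>'_def by (rule tensor_f_cases[OF \<psi>x, of ?l ?k c]) (use ne'' that in auto)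
  \<comment> \<open>The nodes \<open>\<delta>\<close> and \<open>\<delta>'\<close> may lie in
    different factors. Only the resulting pairs are comparable, through the commutation of \<psi>
    with the f operators.\<close>
  have yy': "y' = \<psi> y" using y(1) y'(1) iso x unfolding tensor_crystal_iso_def by fastforce
  have "(Addable, \<delta>) \<in> set (tensor_word ?k ?l c (pair L))"
    unfolding \<delta>_def using ne' by (intro set_uncancelled last_in_set)
  then have add: "addable [L ! i, L ! (i - 1)] \<delta>" unfolding tensor_word(2)[OF x] by auto
  have "(Addable, \<delta>') \<in> set (tensor_word ?l ?k c (\<psi> (pair L)))"
    unfolding \<delta>'_def using ne'' by (intro set_uncancelled last_in_set)
  then have "addable [fst (\<psi> (pair L)), snd (\<psi> (pair L))] \<delta>'"
    unfolding tensor_word(2)[OF \<psi>x] by auto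
  then have add': "addable [\<Phi> L ! i, \<Phi> L ! (i - 1)] \<delta>'"
    by (simp only: \<Phi>_nth(1)[OF L, symmetric] fst_conv snd_conv)
  have 1: "add_node L (relabel i \<delta>) = L[i - 1 := snd y, i := fst y]"
    by (rule add_node_relabel[OF L i add]) (use y(2) in simp)
  have 2: "add_node (\<Phi> L) (relabel i \<delta>') = (\<Phi> L)[i - 1 := snd y', i := fst y']"
    by (rule add_node_relabel[OF \<Phi>_mem[OF L] i add']) (use y'(2) in \<open>simp only: \<Phi>_nth(1)[OF L, symmetric] fst_conv snd_conv\<close>)
  have upd: "K[i - 1 := a, i := b, i - 1 := c, i := d] = K[i - 1 := c, i := d]" for K :: "nat list list" and a b c d
    using i by (simp add: list_update_swap[of i "i - Suc 0"])
  have "pair (L[i - 1 := snd y, i := fst y]) = y" using i len by simp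
  then have "\<Phi> (add_node L (relabel i \<delta>)) = L[i - 1 := snd (\<psi> y), i := fst (\<psi> y)]"
    unfolding 1 exchange_def by (simp only: upd)
  also have "\<dots> = add_node (\<Phi> L) (relabel i \<delta>')"
    unfolding 2 yy' unfolding exchange_def upd ..
  finally show ?thesis
    unfolding C block_inside[OF L] uncancelled_map last_map[OF ne'] last_map[OF ne''] \<delta>_def \<delta>'_def .
qed

text \<open>The condition on nodes is a predicate \<open>Q\<close> of the content, so that the same
  set of contents can be read for both multicharges.\<close>

lemma f_op_exchange:
  assumes L: "L \<in> multipartitions (length s)"
    and ord: "node_order s (\<lambda>\<gamma> \<delta>. node_less s \<delta> \<gamma>) (\<lambda>\<gamma>. Q (content s \<gamma>))"
      "node_order s' (\<lambda>\<gamma> \<delta>. node_less s' \<delta> \<gamma>) (\<lambda>\<gamma>. Q (content s' \<gamma>))"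
  shows "f_op (\<lambda>\<gamma> \<delta>. node_less s' \<delta> \<gamma>) (\<lambda>\<gamma>. Q (content s' \<gamma>)) (\<Phi> L) =
    map_option \<Phi> (f_op (\<lambda>\<gamma> \<delta>. node_less s \<delta> \<gamma>) (\<lambda>\<gamma>. Q (content s \<gamma>)) L)"
proof -
  note M = \<Phi>_mem[OF L]
  \<comment> \<open>Contents are collected from \<open>L\<close> and from \<open>\<Phi> L\<close>,
    so that both words are cut along the same list and their blocks correspond position by
    position.\<close>
  define D where "D = {c \<in> content s ` ({\<gamma>. addable L \<gamma>} \<union> nodes L) \<union>
    content s' ` ({\<gamma>. addable (\<Phi> L) \<gamma>} \<union> nodes (\<Phi> L)). Q c}"
  define cs where "cs = rev (sorted_list_of_set D)"
  have "finite D" unfolding D_def by (auto simp: finite_addable finite_nodes)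
  then have cs: "set cs = D" "sorted_wrt (>) cs"
    unfolding cs_def by (simp_all add: sorted_wrt_rev)
  \<comment> \<open>Because i - 1 and i are consecutive, no other component is read between them at
    equal content, and three intervals in decreasing order suffice; the last one is empty for i =
    1.\<close>
  define Cs where "Cs = [{i<..}, {i - 1, i}, {..<i - 1}]"
  have Cs: "sorted_wrt (\<lambda>C D. \<forall>x \<in> C. \<forall>y \<in> D. y < x) Cs" "\<Union>(set Cs) = UNIV"
    unfolding Cs_def by auto
  have C: "C = {i - 1, i} \<or> i \<notin> C \<and> i - 1 \<notin> C" if "C \<in> set Cs" for C
    using that unfolding Cs_def by auto
  let ?w = "signature_word (\<lambda>\<gamma> \<delta>. node_less s \<delta> \<gamma>) (\<lambda>\<gamma>. Q (content s \<gamma>)) L"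
  let ?w' = "signature_word (\<lambda>\<gamma> \<delta>. node_less s' \<delta> \<gamma>) (\<lambda>\<gamma>. Q (content s' \<gamma>)) (\<Phi> L)"
  let ?B = "\<lambda>(c, C). block s c C L" and ?B' = "\<lambda>(c, C). block s' c C (\<Phi> L)"
  have w: "?w = concat (map ?B (List.product cs Cs))"
    by (rule signature_word_eq_concat_blocks[OF L ord(1) cs(2) _ _ Cs])
      (auto simp: cs(1) D_def removable_def)
  have w': "?w' = concat (map ?B' (List.product cs Cs))"
    by (rule signature_word_eq_concat_blocks[OF M ord(2) cs(2) _ _ Cs])
      (auto simp: cs(1) D_def removable_def)
  have "list_all2 (\<lambda>w w'. \<forall>x. length (uncancelled x w) = length (uncancelled x w'))
      (map ?B (List.product cs Cs)) (map ?B' (List.product cs Cs))"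
    unfolding list.rel_map
  proof (intro list.rel_refl_strong allI)
    fix p x assume "p \<in> set (List.product cs Cs)"
    then obtain c C' where p: "p = (c, C')" "C' \<in> set Cs" by auto
    show "length (uncancelled x (?B p)) = length (uncancelled x (?B' p))"
      unfolding p(1) prod.case by (rule length_block_exchange[OF L C[OF p(2)], symmetric])
  qed
  from last_uncancelled_concat[OF this, folded w w']
  have len: "length (uncancelled x ?w) = length (uncancelled x ?w')"
    and last: "uncancelled Addable ?w \<noteq> [] \<Longrightarrow>
      \<exists>(v, v') \<in> set (zip (map ?B (List.product cs Cs)) (map ?B' (List.product cs Cs))).
        uncancelled Addable v \<noteq> [] \<and> last (uncancelled Addable ?w) = last (uncancelled Addable v) \<and>
        last (uncancelled Addable ?w') = last (uncancelled Addable v')" for x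
    by blast+
  have zip: "zip (map f xs) (map g xs) = map (\<lambda>p. (f p, g p)) xs" for f g :: "int \<times> nat set \<Rightarrow> (letter \<times> node) list" and xs
    by (induction xs) auto
  show ?thesis
  proof (cases "uncancelled Addable ?w = []")
    case True
    then have "uncancelled Addable ?w' = []" using len[of Addable] by simp
    with True show ?thesis by (simp add: f_op_def remaining_eq_uncancelled)
  next
    case False
    then obtain v v' where vv': "(v, v') \<in> set (zip (map ?B (List.product cs Cs)) (map ?B' (List.product cs Cs)))"
        "uncancelled Addable v \<noteq> []"
        "last (uncancelled Addable ?w) = last (uncancelled Addable v)"
        "last (uncancelled Addable ?w') = last (uncancelled Addable v')"
      using last by blast
    obtain c C' where cC: "C' \<in> set Cs" "v = block s c C' L" "v' = block s' c C' (\<Phi> L)"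
      using vv'(1) unfolding zip by auto
    have "\<Phi> (add_node L (last (uncancelled Addable ?w))) = add_node (\<Phi> L) (last (uncancelled Addable ?w'))"
      unfolding vv'(3,4) cC(2,3) by (rule add_last_block_exchange[OF L C[OF cC(1)] vv'(2)[unfolded cC(2)]])
    moreover have "uncancelled Addable ?w' \<noteq> []" using len[of Addable] False by auto
    ultimately show ?thesis using False by (simp add: f_op_def remaining_eq_uncancelled)
  qed
qed

end

section \<open>Connected affine crystals\<close>

text \<open>For e >= 2 consecutive integers are incongruent modulo e, so contents in one residue
  class never differ by one.\<close>

lemma node_order_residue:
  assumes "e \<ge> 2"
  shows "node_order s (\<lambda>\<gamma> \<delta>. node_less s \<delta> \<gamma>) (\<lambda>\<gamma>. [content s \<gamma> = r] (mod int e))"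
proof (rule node_order_affine)
  fix \<gamma> \<delta> assume "[content s \<gamma> = r] (mod int e)" "[content s \<delta> = r] (mod int e)"
  then have "[content s \<delta> = content s \<gamma>] (mod int e)" using cong_trans cong_sym by blast
  then have dvd: "int e dvd \<bar>content s \<delta> - content s \<gamma>\<bar>" by (simp add: cong_iff_dvd_diff)
  show "\<bar>content s \<delta> - content s \<gamma>\<bar> \<noteq> 1"
  proof
    assume "\<bar>content s \<delta> - content s \<gamma>\<bar> = 1"
    with dvd have "int e dvd 1" by (simp only:)
    then show False using assms by simp
  qed
qed

text \<open>The third clause grades the crystal by the number of nodes; the behaviour of an
  isomorphism at the empty multipartition is derived from it.\<close>

lemma arrowD:
  assumes "arrow e s r L M" "e \<ge> 2"
  shows "L \<in> multipartitions (length s)" "M \<in> multipartitions (length s)"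
    "card (nodes M) = Suc (card (nodes L))"
proof -
  show L: "L \<in> multipartitions (length s)" using assms(1) by (simp add: arrow_def)
  interpret node_order s "\<lambda>\<gamma> \<delta>. node_less s \<delta> \<gamma>" "\<lambda>\<gamma>. [content s \<gamma> = int r] (mod int e)"
    by (rule node_order_residue[OF assms(2)])
  have f: "f_op (\<lambda>\<gamma> \<delta>. node_less s \<delta> \<gamma>) (\<lambda>\<gamma>. [content s \<gamma> = int r] (mod int e)) L = Some M"
    using assms(1) by (simp add: arrow_def)
  obtain \<gamma> where \<gamma>: "addable L \<gamma>" "M = add_node L \<gamma>" "M \<in> multipartitions (length s)"
    by (rule f_op_Some[OF L f], rule that)
  then have "nodes M = insert \<gamma> (nodes L)" "\<gamma> \<notin> nodes L"
    using add_node(2)[OF \<gamma>(1)] by (auto simp: addable_def)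
  then show "card (nodes M) = Suc (card (nodes L))" by (simp add: finite_nodes)
  show "M \<in> multipartitions (length s)" by fact
qed

lemma arrow_fun: "arrow e s r L M \<Longrightarrow> arrow e s r L M' \<Longrightarrow> M = M'"
  by (simp add: arrow_def)

lemma arrow_inj:
  assumes "arrow e s r L M" "arrow e s r L' M" "e \<ge> 2"
  shows "L = L'"
  using assms(1,2) unfolding arrow_def
  by (intro node_order.f_op_inj[OF node_order_residue[OF assms(3)]]) blast+

lemma (in adjacent_exchange) arrow_exchange:
  assumes "arrow e s r L M" "e \<ge> 2"
  shows "arrow e s' r (\<Phi> L) (\<Phi> M)"
proof -
  have L: "L \<in> multipartitions (length s)" using assms(1) by (simp add: arrow_def)
  show ?thesis
    using assms(1) \<Phi>_mem[OF L]
      f_op_exchange[OF L, of "\<lambda>c. [c = int r] (mod int e)", OF node_order_residue node_order_residue, OF assms(2,2)]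
    by (simp add: arrow_def)
qed

text \<open>A path for \<open>equivclp\<close> follows arrows in both directions, hence two step
  cases. Both ends of each arrow are kept in the component, because the property defining an
  isomorphism speaks only of vertices there.\<close>

lemma affine_crystal_induct [consumes 1, case_names empty forward backward]:
  assumes "L \<in> affine_crystal e s"
    and "P (empty_multipartition (length s))"
    and "\<And>L M r. L \<in> affine_crystal e s \<Longrightarrow> M \<in> affine_crystal e s \<Longrightarrow> P L \<Longrightarrow> arrow e s r L M \<Longrightarrow> P M"
    and "\<And>L M r. L \<in> affine_crystal e s \<Longrightarrow> M \<in> affine_crystal e s \<Longrightarrow> P L \<Longrightarrow> arrow e s r M L \<Longrightarrow> P M"
  shows "P L"
proof -
  let ?R = "\<lambda>M N. \<exists>r. arrow e s r M N"
  have "equivclp ?R (empty_multipartition (length s)) L" using assms(1) by (simp add: affine_crystal_def)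
  then have "L \<in> affine_crystal e s \<and> P L"
  proof (induction rule: equivclp_induct)
    case base
    show ?case using assms(2) by (simp add: affine_crystal_def)
  next
    case (step M N)
    have N: "N \<in> affine_crystal e s"
      unfolding affine_crystal_def mem_Collect_eq by (rule equivclp_into_equivclp[OF step(1,2)])
    have M: "M \<in> affine_crystal e s" "P M" using step.IH by auto
    from step(2) show ?case
    proof (elim disjE exE)
      show ?thesis if "arrow e s r M N" for r using N assms(3)[OF M(1) N M(2) that] by simp
      show ?thesis if "arrow e s r N M" for r using N assms(4)[OF M(1) N M(2) that] by simp
    qed
  qed
  then show ?thesis by blast
qed

lemma nodes_empty_multipartition: "nodes (empty_multipartition l) = {}"
  by (auto simp: nodes_def empty_multipartition_def)

lemma empty_multipartition_mem:
  "empty_multipartition l \<in> multipartitions l" "empty_multipartition (length s) \<in> affine_crystal e s"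
  by (auto simp: multipartitions_def partitions_def empty_multipartition_def affine_crystal_def)

lemma affine_crystal_subset: "L \<in> affine_crystal e s \<Longrightarrow> e \<ge> 2 \<Longrightarrow> L \<in> multipartitions (length s)"
  by (induction rule: affine_crystal_induct) (auto simp: empty_multipartition_mem dest: arrowD)

lemma affine_crystal_iso_arrow:
  assumes "affine_crystal_iso e s s' \<Gamma>" "L \<in> affine_crystal e s" "M \<in> affine_crystal e s" "arrow e s r L M"
  shows "arrow e s' r (\<Gamma> L) (\<Gamma> M)"
  using assms unfolding affine_crystal_iso_def by (auto simp: arrow_def)

text \<open>The difference of the numbers of nodes of \<open>\<Gamma> L\<close> and \<open>L\<close> is constant on the connected crystal,
  and evaluating it at the empty multipartition and at its preimage shows that it vanishes.\<close>

lemma affine_crystal_iso_empty: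
  assumes iso: "affine_crystal_iso e s s' \<Gamma>" and e: "e \<ge> 2"
  shows "\<Gamma> (empty_multipartition (length s)) = empty_multipartition (length s')"
proof -
  let ?E = "empty_multipartition (length s)" and ?E' = "empty_multipartition (length s')"
  have bij: "bij_betw \<Gamma> (affine_crystal e s) (affine_crystal e s')"
    using iso by (simp add: affine_crystal_iso_def)
  have card: "card (nodes (\<Gamma> L)) = card (nodes L) + card (nodes (\<Gamma> ?E))" if "L \<in> affine_crystal e s" for L
    using that
  proof (induction rule: affine_crystal_induct)
    case empty
    show ?case by (simp add: nodes_empty_multipartition)
  next
    case (forward L M r)
    then show ?case
      using arrowD(3)[OF _ e] affine_crystal_iso_arrow[OF iso forward(1,2)] by fastforce
  next
    case (backward L M r)
    then show ?case
      using arrowD(3)[OF _ e] affine_crystal_iso_arrow[OF iso backward(2,1)] by fastforce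
  qed
  obtain L where "L \<in> affine_crystal e s" "\<Gamma> L = ?E'"
    using bij empty_multipartition_mem(2)[of s' e] by (metis bij_betw_iff_bijections)
  then have "card (nodes (\<Gamma> ?E)) = 0" using card[of L] by (simp add: nodes_empty_multipartition)
  then have "nodes (\<Gamma> ?E) = nodes ?E'" by (simp add: finite_nodes nodes_empty_multipartition)
  moreover have "\<Gamma> ?E \<in> multipartitions (length s')"
    using bij_betwE[OF bij] empty_multipartition_mem(2) affine_crystal_subset[OF _ e] by blast
  ultimately show ?thesis using empty_multipartition_mem(1) by (intro inj_onD[OF inj_on_nodes])
qed

theorem proposition5p2p2:
  fixes e l i :: nat
    and s :: "int list"
    and \<Sigma> :: "nat list list \<Rightarrow> nat list list"
    and \<psi> :: "nat list \<times> nat list \<Rightarrow> nat list \<times> nat list"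
    and L :: "nat list list"
    and \<mu> \<nu> :: "nat list"
  assumes "e \<ge> 2" and "l \<ge> 2" and "length s = l" and "i \<in> {1..l - 1}"
    and "affine_crystal_iso e s (s[i - 1 := s ! i, i := s ! (i - 1)]) \<Sigma>"
    and "tensor_crystal_iso (s ! i) (s ! (i - 1)) \<psi>"
    and "L \<in> affine_crystal e s"
    and "\<psi> (L ! i, L ! (i - 1)) = (\<mu>, \<nu>)"
  shows "\<Sigma> L = L[i - 1 := \<nu>, i := \<mu>]"
proof -
  interpret adjacent_exchange s i \<psi>
    by standard (use assms in auto)
  note iso = assms(5)
  have "\<Sigma> L = \<Phi> L"
    using assms(7)
  proof (induction rule: affine_crystal_induct)
    case empty
    have "(replicate n [])[j := []] = (replicate n [] :: nat list list)" for n j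
      by (metis linorder_not_less list_update_beyond list_update_id length_replicate nth_replicate)
    then show ?case
      using i affine_crystal_iso_empty[OF iso assms(1)] tensor_crystal_iso_empty[OF assms(6)]
      by (simp add: exchange_def empty_multipartition_def)
  next
    case (forward L M r)
    \<comment> \<open>\<Sigma> M and \<Phi> M are both targets of an r-arrow from \<Sigma> L =
      \<Phi> L. Uniqueness of targets holds on all multipartitions, so membership of \<Phi> M in the
      target component follows from the equality instead of being its premise; the backward case
      uses uniqueness of sources in the same way.\<close>
    show ?case
      by (rule arrow_fun[OF affine_crystal_iso_arrow[OF iso forward(1-3), unfolded forward.IH]
        arrow_exchange[OF forward(3) assms(1)]])
  next
    case (backward L M r)
    show ?case
      by (rule arrow_inj[OF affine_crystal_iso_arrow[OF iso backward(2,1,3), unfolded backward.IH]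
        arrow_exchange[OF backward(3) assms(1)] assms(1)])
  qed
  then show ?thesis using assms(8) by (simp add: exchange_def)
qed

end
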